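(* Let $C$ be an $\mathrm{HFP}(4t_{\mathbf u},2)$-code of length $4t$ with $t\ge 4$. Then the dimension $k$ of the kernel of $C$ is $k=1$.
   Context: Let $\mathbb F$ be the binary field. $C_m$ denotes the cyclic group of order $m$. $\mathbf e$ is the all-zero vector and $\mathbf u$ the all-one vector. For $\pi\in S_n$ and $x\in\mathbb F^n$, $\pi(x)=(x_{\pi^{-1}(1)},\ldots,x_{\pi^{-1}(n)})$. A Hadamard code of length $n=4t$ is a set of $2n$ binary vectors consisting of the rows of a binary Hadamard matrix (a Hadamard matrix with $1$ replaced by $0$ and $-1$ replaced by $1$) and their complements. All codes are assumed to contain $\mathbf e$. A binary code $C\subseteq\mathbb F^n$ has a propelinear structure if for each $x\in C$ there is $\pi_x\in S_n$ such that for all $y\in C$: $x+\pi_x(y)\in C$, and $\pi_x\pi_y=\pi_z$ where $z=x+\pi_x(y)$. Then $C$ is a group under $x*y=x+\pi_x(y)$ (written multiplicatively), with identity $\mathbf e$. A Hadamard full propelinear code (HFP-code) is a Hadamard code with a propelinear structure such that $\pi_x$ has no fixed coordinate for every $x\in C\setminus\{\mathbf e,\mathbf u\}$, and $\pi_{\mathbf e}=\pi_{\mathbf u}=I$. An $\mathrm{HFP}(4t_{\mathbf u},2)$-code of length $4t$ is an HFP-code $C=\langle a\rangle\times\langle b\rangle\simeq C_{4t}\times C_2$ with $a^{2t}=\mathbf u$, $b^2=\mathbf e$. The kernel of $C$ is $K(C)=\{z\in\mathbb F^n : C+z=C\}$, a linear subspace contained in $C$; $k=\dim K(C)$. *)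

theory Defs
  imports
    "HOL-Analysis.Determinants"
    "HOL-Algebra.Elementary_Groups"
    "HOL-Algebra.Multiplicative_Group"
    "HOL-Library.Z2"
begin

text \<open>
  Binary vectors of length \<open>n\<close> have type \<^typ>\<open>bit ^ 'n\<close> with \<open>n = CARD('n)\<close>; the all-zero
  vector is \<open>0\<close> and \<open>S\<^sub>n\<close> is the set of permutations of the index type.
\<close>

definition all_one :: "bit ^ 'n" where
  "all_one = (\<chi> i. 1)"

definition perm_vec :: "('n \<Rightarrow> 'n) \<Rightarrow> bit ^ 'n \<Rightarrow> bit ^ 'n" where
  "perm_vec p x = (\<chi> i. x $ inv_into UNIV p i)"

definition hadamard_matrix :: "real ^ 'n ^ 'n \<Rightarrow> bool" where
  "hadamard_matrix H \<longleftrightarrow>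
     (\<forall>i j. H $ i $ j = 1 \<or> H $ i $ j = -1) \<and> H ** transpose H = mat (real CARD('n))"

definition binary_matrix :: "real ^ 'n ^ 'n \<Rightarrow> bit ^ 'n ^ 'n" where
  "binary_matrix H = (\<chi> i j. if H $ i $ j = -1 then 1 else 0)"

text \<open>The complement of a binary vector \<open>r\<close> is \<open>r + all_one\<close>.\<close>

definition hadamard_code :: "(bit ^ 'n) set \<Rightarrow> bool" where
  "hadamard_code C \<longleftrightarrow>
     (\<exists>H. hadamard_matrix H \<and>
          C = rows (binary_matrix H) \<union> (\<lambda>r. r + all_one) ` rows (binary_matrix H))"

definition propelinear :: "(bit ^ 'n) set \<Rightarrow> (bit ^ 'n \<Rightarrow> 'n \<Rightarrow> 'n) \<Rightarrow> bool" where
  "propelinear C \<pi> \<longleftrightarrow>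
     (\<forall>x\<in>C. \<pi> x permutes UNIV) \<and>
     (\<forall>x\<in>C. \<forall>y\<in>C. x + perm_vec (\<pi> x) y \<in> C \<and> \<pi> x \<circ> \<pi> y = \<pi> (x + perm_vec (\<pi> x) y))"

definition propelinear_group :: "(bit ^ 'n) set \<Rightarrow> (bit ^ 'n \<Rightarrow> 'n \<Rightarrow> 'n) \<Rightarrow> (bit ^ 'n) monoid" where
  "propelinear_group C \<pi> =
     \<lparr>carrier = C, monoid.mult = (\<lambda>x y. x + perm_vec (\<pi> x) y), one = 0\<rparr>"

text \<open>
  Codes are assumed to contain the zero vector, which makes \<^const>\<open>propelinear_group\<close> a group.
\<close>

definition hfp_code :: "(bit ^ 'n) set \<Rightarrow> (bit ^ 'n \<Rightarrow> 'n \<Rightarrow> 'n) \<Rightarrow> bool" where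
  "hfp_code C \<pi> \<longleftrightarrow>
     0 \<in> C \<and> hadamard_code C \<and> propelinear C \<pi> \<and>
     (\<forall>x \<in> C - {0, all_one}. \<forall>i. \<pi> x i \<noteq> i) \<and>
     \<pi> 0 = id \<and> \<pi> all_one = id"

text \<open>
  \<open>C = \<langle>a\<rangle> \<times> \<langle>b\<rangle>\<close> is an internal direct product: multiplication is an isomorphism from the
  external product of the two cyclic subgroups onto \<open>C\<close>.  The orders of \<open>a\<close> and \<open>b\<close> say that
  the factors are \<open>C\<^sub>4\<^sub>t\<close> and \<open>C\<^sub>2\<close>.
\<close>

definition hfp_4tu_2_code :: "nat \<Rightarrow> (bit ^ 'n) set \<Rightarrow> (bit ^ 'n \<Rightarrow> 'n \<Rightarrow> 'n) \<Rightarrow> bool" where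
  "hfp_4tu_2_code t C \<pi> \<longleftrightarrow>
     CARD('n) = 4 * t \<and> hfp_code C \<pi> \<and>
     (let G = propelinear_group C \<pi> in
       \<exists>a\<in>C. \<exists>b\<in>C.
         (\<lambda>(x, y). x \<otimes>\<^bsub>G\<^esub> y) \<in>
           iso (subgroup_generated G {a} \<times>\<times> subgroup_generated G {b}) G \<and>
         group.ord G a = 4 * t \<and> group.ord G b = 2 \<and>
         a [^]\<^bsub>G\<^esub> (2 * t) = all_one \<and> b [^]\<^bsub>G\<^esub> (2::nat) = 0)"

definition code_kernel :: "(bit ^ 'n) set \<Rightarrow> (bit ^ 'n) set" where
  "code_kernel C = {z. (\<lambda>x. x + z) ` C = C}"

lemma perm_vec_add: "perm_vec p (x + y) = perm_vec p x + perm_vec p y"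
  by (simp add: perm_vec_def vec_eq_iff)

lemma perm_vec_comp:
  assumes "p permutes UNIV" "q permutes UNIV"
  shows "perm_vec p (perm_vec q x) = perm_vec (p \<circ> q) x"
  using assms by (simp add: perm_vec_def vec_eq_iff o_inv_distrib[OF permutes_bij permutes_bij])

lemma group_propelinear_group:
  fixes C :: "(bit ^ 'n) set"
  assumes "propelinear C \<pi>" and "0 \<in> C" and "finite C"
  shows "group (propelinear_group C \<pi>)"
proof (rule groupI)
  let ?G = "propelinear_group C \<pi>"
  have perm: "\<pi> x permutes UNIV" if "x \<in> C" for x
    using assms that by (auto simp: propelinear_def)
  have closed: "x + perm_vec (\<pi> x) y \<in> C" if "x \<in> C" "y \<in> C" for x y
    using assms that by (auto simp: propelinear_def)
  have pi_mult: "\<pi> (x + perm_vec (\<pi> x) y) = \<pi> x \<circ> \<pi> y" if "x \<in> C" "y \<in> C" for x y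
    using assms that by (auto simp: propelinear_def)
  have zero: "perm_vec p 0 = 0" for p :: "'n \<Rightarrow> 'n"
    by (simp add: perm_vec_def vec_eq_iff)
  have "\<pi> 0 \<circ> \<pi> 0 = \<pi> 0"
    using pi_mult[of 0 0] assms(2) by (simp add: zero)
  then have pi_zero: "\<pi> 0 = id"
    using permutes_inj[OF perm[OF assms(2)]] by (auto simp: fun_eq_iff inj_def)
  have inj: "y = y'" if "x \<in> C" "perm_vec (\<pi> x) y = perm_vec (\<pi> x) y'" for x y y'
  proof -
    have "perm_vec (\<pi> x) y $ \<pi> x i = perm_vec (\<pi> x) y' $ \<pi> x i" for i
      using that by simp
    then show ?thesis
      using perm[OF that(1)] by (simp add: perm_vec_def permutes_inverses vec_eq_iff)
  qed
  have right_inv: "\<exists>y\<in>C. x + perm_vec (\<pi> x) y = 0" if "x \<in> C" for x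
  proof -
    have "inj_on (\<lambda>y. x + perm_vec (\<pi> x) y) C"
      using inj[OF that] by (auto simp: inj_on_def)
    then have "(\<lambda>y. x + perm_vec (\<pi> x) y) ` C = C"
      using closed[OF that] assms(3) by (intro endo_inj_surj) auto
    then have "0 \<in> (\<lambda>y. x + perm_vec (\<pi> x) y) ` C"
      using assms(2) by (rule ssubst)
    then show ?thesis by (elim imageE) (rule bexI, rule sym)
  qed
  show "\<one>\<^bsub>?G\<^esub> \<in> carrier ?G"
    using assms(2) by (simp add: propelinear_group_def)
  show "x \<otimes>\<^bsub>?G\<^esub> y \<in> carrier ?G" if "x \<in> carrier ?G" "y \<in> carrier ?G" for x y
    using that closed by (simp add: propelinear_group_def)
  show assoc: "x \<otimes>\<^bsub>?G\<^esub> y \<otimes>\<^bsub>?G\<^esub> z = x \<otimes>\<^bsub>?G\<^esub> (y \<otimes>\<^bsub>?G\<^esub> z)"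
    if "x \<in> carrier ?G" "y \<in> carrier ?G" "z \<in> carrier ?G" for x y z
    using that
    by (simp add: propelinear_group_def pi_mult perm_vec_add
        perm_vec_comp[OF perm perm] add.assoc)
  show one: "\<one>\<^bsub>?G\<^esub> \<otimes>\<^bsub>?G\<^esub> x = x" if "x \<in> carrier ?G" for x
    by (simp add: propelinear_group_def pi_zero perm_vec_def vec_eq_iff)
  show "\<exists>y\<in>carrier ?G. y \<otimes>\<^bsub>?G\<^esub> x = \<one>\<^bsub>?G\<^esub>" if x: "x \<in> carrier ?G" for x
  proof -
    obtain y where y: "y \<in> carrier ?G" "x \<otimes>\<^bsub>?G\<^esub> y = \<one>\<^bsub>?G\<^esub>"
      using right_inv x by (auto simp: propelinear_group_def)
    obtain z where z: "z \<in> carrier ?G" "y \<otimes>\<^bsub>?G\<^esub> z = \<one>\<^bsub>?G\<^esub>"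
      using right_inv y(1) by (auto simp: propelinear_group_def)
    have "x \<otimes>\<^bsub>?G\<^esub> \<one>\<^bsub>?G\<^esub> = x"
      by (simp add: propelinear_group_def zero)
    then have "x = z"
      using assoc[OF x y(1) z(1)] y z one by simp
    then show ?thesis using y z by blast
  qed
qed

end

theory Submission
  imports Defs
begin

text \<open>
  Write \<open>u\<close> for the all-one vector.  Fix a coordinate and let \<open>f g \<in> {1, -1}\<close> be the sign of
  that coordinate of the codeword \<open>g\<close>.  Since \<open>C\<close> modulo \<open>u\<close> acts regularly on the coordinates,
  the balance of the codewords other than \<open>0\<close> and \<open>u\<close> becomes a correlation property: for such
  \<open>x\<close>, the sum of \<open>f h * f (h x)\<close> over \<open>h\<close> modulo \<open>u\<close> vanishes.  The group \<open>C\<^sub>4\<^sub>t \<times> C\<^sub>2\<close> turns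
  \<open>f\<close> into two sign sequences \<open>\<alpha> i = f (a\<^sup>i)\<close> and \<open>\<beta> i = f (a\<^sup>i b)\<close>, which change sign after
  \<open>2 t\<close> steps and have vanishing auto- and cross-correlations (\<open>negaperiodic_pair\<close>).

  Suppose that the kernel contains more than \<open>0\<close> and \<open>u\<close>.  It is a subgroup of \<open>C\<close> whose order is a
  power of two, as it is also a binary linear space, so it contains one of the three
  elements \<open>b\<close>, \<open>q\<close>, \<open>q b\<close> that have order two modulo \<open>u\<close>, where \<open>q = a\<^sup>t\<close>.  The permutation of
  \<open>a\<close> permutes those of them that lie in the kernel, up to complement, and it cannot permute all
  three cyclically.  Hence one of them, \<open>z\<close>, is mapped to itself or to its complement
  (\<open>exists_translation_stable_involution\<close>).  In terms of \<open>f\<close>, multiplication by \<open>z\<close> multiplies the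
  sequences \<open>\<alpha>\<close> and \<open>\<beta>\<close> by \<open>\<eta>\<^sup>i\<close> with a fixed sign \<open>\<eta>\<close>, up to a constant sign.

  So \<open>\<beta>\<close> is a modulated copy of \<open>\<alpha>\<close> (for \<open>z = b\<close>), or each of \<open>\<alpha>\<close> and \<open>\<beta>\<close> is a modulated copy of
  itself half a period later (for \<open>z = q\<close>), or \<open>\<beta>\<close> is such a copy of \<open>\<alpha>\<close> half a period later (for
  \<open>z = q b\<close>).  Each of these contradicts the vanishing of a few correlations, mostly by a parity
  argument: a vanishing sum of \<open>n\<close> signs has \<open>n / 2\<close> negative terms, so the product of the signs
  is determined by \<open>n\<close>, while the product over one period of \<open>c i * c (i + s)\<close> telescopes.
\<close>

section \<open>Sums of signs and telescoping products\<close>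

definition bit_sign :: "bit \<Rightarrow> int" where
  "bit_sign x = (if x = 0 then 1 else - 1)"

lemma bit_sign_cases: "bit_sign x = 1 \<or> bit_sign x = - 1"
  by (simp add: bit_sign_def)

lemma bit_sign_add: "bit_sign (x + y) = bit_sign x * bit_sign y"
  by (cases x; cases y) (simp_all add: bit_sign_def)

text \<open>
  With \<open>k\<close> negative terms the sum is \<open>card A - 2 k\<close> and the product is \<open>(-1)\<^sup>k\<close>, which is
  \<open>1 - 2 k\<close> modulo \<open>4\<close>.  The parity contradictions below apply this congruence to vanishing sums.
\<close>

lemma sum_of_signs_mod_4:
  fixes g :: "'a \<Rightarrow> int"
  assumes "finite A" and "\<And>i. i \<in> A \<Longrightarrow> g i = 1 \<or> g i = - 1"
  shows "4 dvd sum g A - (int (card A) + prod g A - 1)"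
proof -
  \<comment> \<open>The induction step needs that the product is a sign.\<close>
  have "4 dvd sum g A - (int (card A) + prod g A - 1) \<and> (prod g A = 1 \<or> prod g A = - 1)"
    using assms
  proof (induction A rule: finite_induct)
    case empty
    then show ?case by simp
  next
    case (insert x F)
    then have IH: "4 dvd sum g F - (int (card F) + prod g F - 1)"
      and p: "prod g F = 1 \<or> prod g F = - 1" and "g x = 1 \<or> g x = - 1"
      by auto
    show ?case
      using \<open>g x = 1 \<or> g x = - 1\<close>
    proof
      assume "g x = 1"
      then show ?thesis using IH p insert(1,2) by (simp add: algebra_simps)
    next
      assume gx: "g x = - 1"
      have "4 dvd (sum g F - (int (card F) + prod g F - 1)) - 2 * (1 - prod g F)"
        using p by (intro dvd_diff[OF IH]) auto
      moreover have "sum g (insert x F) - (int (card (insert x F)) + prod g (insert x F) - 1) =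
          (sum g F - (int (card F) + prod g F - 1)) - 2 * (1 - prod g F)"
        using gx insert(1,2) by simp
      moreover have "prod g (insert x F) = - prod g F"
        using gx insert(1,2) by simp
      ultimately show ?thesis using p by (metis minus_minus)
    qed
  qed
  then show ?thesis by blast
qed

lemma prod_signs_shift_1:
  fixes c :: "nat \<Rightarrow> int"
  assumes "\<And>i. c i = 1 \<or> c i = - 1"
  shows "(\<Prod>i<m. c i * c (i + 1)) = c 0 * c m"
proof (induction m)
  case 0
  then show ?case using assms[of 0] by auto
next
  case (Suc m)
  then show ?case using assms[of m] by auto
qed

lemma prod_signs_shift_2:
  fixes c :: "nat \<Rightarrow> int"
  assumes "\<And>i. c i = 1 \<or> c i = - 1"
  shows "(\<Prod>i<m. c i * c (i + 2)) = c 0 * c 1 * c m * c (m + 1)"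
proof -
  have "c i * c (i + 2) = (c i * c (i + 1)) * (c (i + 1) * c (i + 1 + 1))" for i
    using assms[of "i + 1"] by auto
  then have "(\<Prod>i<m. c i * c (i + 2)) =
      (\<Prod>i<m. c i * c (i + 1)) * (\<Prod>i<m. c (i + 1) * c (i + 1 + 1))"
    by (simp only: prod.distrib)
  also have "\<dots> = (c 0 * c m) * (c 1 * c (m + 1))"
    using prod_signs_shift_1[of c] prod_signs_shift_1[of "\<lambda>i. c (i + 1)"] assms by simp
  finally show ?thesis by simp
qed

text \<open>
  The first row of a negacyclic Hadamard matrix of order \<open>m > 2\<close> would satisfy these hypotheses.  By
  telescoping, the \<open>m\<close> signs in the sum for shift \<open>1\<close> have product \<open>-1\<close> and those for shift \<open>2\<close> have
  product \<open>1\<close>, but two vanishing sums of \<open>m\<close> signs must have the same product.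
\<close>

lemma no_negacyclic_Hadamard_sequence:
  fixes c :: "nat \<Rightarrow> int"
  assumes sgn: "\<And>i. c i = 1 \<or> c i = - 1" and neg: "\<And>i. c (i + m) = - c i"
    and shift_1: "(\<Sum>i<m. c i * c (i + 1)) = 0"
    and shift_2: "(\<Sum>i<m. c i * c (i + 2)) = 0"
  shows False
proof -
  have sgn2: "c i * c j = 1 \<or> c i * c j = - 1" for i j
    using sgn[of i] sgn[of j] by auto
  have p1: "(\<Prod>i<m. c i * c (i + 1)) = - 1"
    using sgn[of 0] neg[of 0] prod_signs_shift_1[of c m, OF sgn] by auto
  have p2: "(\<Prod>i<m. c i * c (i + 2)) = 1"
    using sgn[of 0] neg[of 0] sgn[of 1] neg[of 1] prod_signs_shift_2[of c m, OF sgn]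
    by (auto simp: add.commute)
  show False
    using sum_of_signs_mod_4[of "{..<m}" "\<lambda>i. c i * c (i + 1)", OF _ sgn2]
      sum_of_signs_mod_4[of "{..<m}" "\<lambda>i. c i * c (i + 2)", OF _ sgn2]
    unfolding p1 p2 shift_1 shift_2 by simp presburger
qed

lemma sum_periodic_shift:
  fixes g :: "nat \<Rightarrow> int"
  assumes "\<And>i. g (i + m) = g i"
  shows "(\<Sum>i<m. g (i + k)) = (\<Sum>i<m. g i)"
proof (induction k)
  case (Suc k)
  have "(\<Sum>i<m. g (i + Suc k)) + g k = (\<Sum>i<Suc m. g (i + k))"
    by (simp add: sum.lessThan_Suc_shift del: sum.lessThan_Suc)
  also have "\<dots> = (\<Sum>i<m. g (i + k)) + g k"
    using assms[of k] by (simp add: add.commute)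
  finally show ?case using Suc by simp
qed simp

lemma sum_two_periods:
  fixes g :: "nat \<Rightarrow> int"
  assumes "\<And>i. g (i + m) = g i"
  shows "(\<Sum>i<2 * m. g i) = 2 * (\<Sum>i<m. g i)"
proof -
  have split: "(\<Sum>i<m + k. g i) = (\<Sum>i<m. g i) + (\<Sum>i<k. g (i + m))" for k
    by (induction k) (simp_all add: add.commute)
  show ?thesis
    unfolding mult_2 split by (simp add: assms)
qed

lemma sum_even_odd_split:
  fixes g :: "nat \<Rightarrow> int"
  shows "(\<Sum>i<2 * t. g i) = (\<Sum>i<t. g (2 * i) + g (2 * i + 1))"
  by (induction t) simp_all

section \<open>Negaperiodic pairs of sign sequences\<close>

text \<open>
  The sequences attached to a code, abstracted from it.  The correlation conditions say
  that the block matrix with rows \<open>(A, B)\<close> and \<open>(B, A)\<close> is a Hadamard matrix, where \<open>A\<close> and \<open>B\<close> are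
  the negacyclic matrices of order \<open>2 t\<close> with first rows \<open>\<alpha>\<close> and \<open>\<beta>\<close>.
\<close>

locale negaperiodic_pair =
  fixes t :: nat and \<alpha> \<beta> :: "nat \<Rightarrow> int"
  assumes \<alpha>_sign: "\<alpha> i = 1 \<or> \<alpha> i = - 1"
    and \<beta>_sign: "\<beta> i = 1 \<or> \<beta> i = - 1"
    and \<alpha>_neg: "\<alpha> (i + 2 * t) = - \<alpha> i"
    and \<beta>_neg: "\<beta> (i + 2 * t) = - \<beta> i"
    and auto_corr: "0 < s \<Longrightarrow> s < 2 * t \<Longrightarrow> (\<Sum>i<2 * t. \<alpha> i * \<alpha> (i + s) + \<beta> i * \<beta> (i + s)) = 0"
    and cross_corr: "(\<Sum>i<2 * t. \<alpha> i * \<beta> (i + s) + \<beta> i * \<alpha> (i + s)) = 0"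
begin

text \<open>
  If \<open>\<eta> = 1\<close>, the cross-correlation at shift \<open>0\<close> is \<open>4 t e\<close>.  If \<open>\<eta> = -1\<close>, then at an even shift the
  autocorrelation and the cross-correlation are the plain and the alternating sum of
  \<open>\<alpha> i * \<alpha> (i + s)\<close>; adding them isolates the even indices, so that the even-indexed half of \<open>\<alpha>\<close>
  is a negacyclic Hadamard sequence of length \<open>t\<close>.
\<close>

lemma no_modulated_copy:
  assumes "t \<ge> 3" and \<eta>: "\<eta> = 1 \<or> \<eta> = - 1" and e: "e = 1 \<or> e = - 1"
    and \<beta>: "\<And>i. \<beta> i = e * \<eta> ^ i * \<alpha> i"
  shows False
  using \<eta>
proof
  assume "\<eta> = 1"
  then have c: "\<alpha> i * \<beta> (i + 0) + \<beta> i * \<alpha> (i + 0) = 2 * e" for i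
    using \<alpha>_sign[of i] by (auto simp: \<beta>)
  have "int (2 * t) * (2 * e) = 0"
    using cross_corr[of 0] unfolding c by simp
  then show False using assms(1) e by auto
next
  assume \<eta>: "\<eta> = - 1"
  \<comment> \<open>\<open>A\<close> is the autocorrelation and \<open>B\<close> the cross-correlation at shift \<open>2 k\<close>.\<close>
  have even: "(\<Sum>i<t. \<alpha> (2 * i) * \<alpha> (2 * i + 2 * k)) = 0" if "0 < k" "k < t" for k
  proof -
    let ?g = "\<lambda>i. \<alpha> i * \<alpha> (i + 2 * k)"
    have "\<alpha> i * \<alpha> (i + 2 * k) + \<beta> i * \<beta> (i + 2 * k) = 2 * ?g i" for i
      using e by (cases "even i") (auto simp: \<beta> \<eta>)
    then have A: "(\<Sum>i<2 * t. ?g i) = 0"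
      using auto_corr[of "2 * k"] that by (simp flip: sum_distrib_left)
    have "\<alpha> i * \<beta> (i + 2 * k) + \<beta> i * \<alpha> (i + 2 * k) = 2 * e * ((- 1) ^ i * ?g i)" for i
      by (cases "even i") (auto simp: \<beta> \<eta>)
    then have B: "(\<Sum>i<2 * t. (- 1) ^ i * ?g i) = 0"
      using cross_corr[of "2 * k"] e by (auto simp flip: sum_distrib_left)
    have "(\<Sum>i<2 * t. ?g i + (- 1) ^ i * ?g i) = 0"
      using A B by (simp only: sum.distrib)
    then have "(\<Sum>i<t. 2 * ?g (2 * i)) = 0"
      unfolding sum_even_odd_split by simp
    then show ?thesis by (simp flip: sum_distrib_left)
  qed
  show False
  proof (rule no_negacyclic_Hadamard_sequence[of "\<lambda>i. \<alpha> (2 * i)" t])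
    show "\<alpha> (2 * i) = 1 \<or> \<alpha> (2 * i) = - 1" for i by (rule \<alpha>_sign)
    show "\<alpha> (2 * (i + t)) = - \<alpha> (2 * i)" for i
      using \<alpha>_neg[of "2 * i"] by (simp add: algebra_simps)
    show "(\<Sum>i<t. \<alpha> (2 * i) * \<alpha> (2 * (i + 1))) = 0"
      using even[of 1] assms(1) by (simp add: algebra_simps)
    show "(\<Sum>i<t. \<alpha> (2 * i) * \<alpha> (2 * (i + 2))) = 0"
      using even[of 2] assms(1) by (simp add: distrib_left del: add_2_eq_Suc')
  qed
qed

text \<open>
  Shifting twice by \<open>t\<close> shows \<open>\<eta>\<^sup>t = -1\<close>, so \<open>t\<close> is odd.  The summands of the autocorrelation at
  shift \<open>2\<close> have period \<open>t\<close>, so half of them, \<open>2 t\<close> signs, already sum to zero.  Their product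
  is \<open>1\<close>, which forces \<open>t\<close> to be even.
\<close>

lemma no_half_period_modulation:
  assumes "t \<ge> 2" and \<eta>: "\<eta> = 1 \<or> \<eta> = - 1"
    and e: "e = 1 \<or> e = - 1" and e': "e' = 1 \<or> e' = - 1"
    and \<alpha>: "\<And>i. \<alpha> (i + t) = e * \<eta> ^ i * \<alpha> i"
    and \<beta>: "\<And>i. \<beta> (i + t) = e' * \<eta> ^ i * \<beta> i"
  shows False
proof -
  have "- \<alpha> 0 = \<eta> ^ t * \<alpha> 0"
    using \<alpha>_neg[of 0] \<alpha>[of t] \<alpha>[of 0] e by (auto simp: mult_2)
  then have "\<eta> ^ t = - 1"
    using \<alpha>_sign[of 0] by auto
  then have \<eta>1: "\<eta> = - 1" and odd: "odd t"
    using \<eta> by (auto simp: minus_one_power_iff split: if_splits)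
  let ?g = "\<lambda>i. \<alpha> i * \<alpha> (i + 2)" and ?h = "\<lambda>i. \<beta> i * \<beta> (i + 2)"
  have per: "?g (i + t) = ?g i" "?h (i + t) = ?h i" for i
    using \<alpha>[of i] \<alpha>[of "i + 2"] \<beta>[of i] \<beta>[of "i + 2"] e e' \<eta>
    by (auto simp: add.commute add.left_commute)
  have zero: "(\<Sum>i<t. ?g i) + (\<Sum>i<t. ?h i) = 0"
    using auto_corr[of 2] assms(1) sum_two_periods[of ?g t, OF per(1)] sum_two_periods[of ?h t, OF per(2)]
    by (simp add: sum.distrib)
  have "(\<Prod>i<t. ?g i) = \<alpha> 0 * \<alpha> 1 * \<alpha> t * \<alpha> (t + 1)"
    by (rule prod_signs_shift_2) (rule \<alpha>_sign)
  then have pg: "(\<Prod>i<t. ?g i) = - 1"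
    using \<alpha>[of 0] \<alpha>[of 1] \<alpha>_sign[of 0] \<alpha>_sign[of 1] e by (auto simp: \<eta>1 add.commute)
  have "(\<Prod>i<t. ?h i) = \<beta> 0 * \<beta> 1 * \<beta> t * \<beta> (t + 1)"
    by (rule prod_signs_shift_2) (rule \<beta>_sign)
  then have ph: "(\<Prod>i<t. ?h i) = - 1"
    using \<beta>[of 0] \<beta>[of 1] \<beta>_sign[of 0] \<beta>_sign[of 1] e' by (auto simp: \<eta>1 add.commute)
  have sg: "?g i = 1 \<or> ?g i = - 1" for i
    using \<alpha>_sign[of i] \<alpha>_sign[of "i + 2"] by auto
  have sh: "?h i = 1 \<or> ?h i = - 1" for i
    using \<beta>_sign[of i] \<beta>_sign[of "i + 2"] by auto
  have "4 dvd (\<Sum>i<t. ?g i) - (int t - 2)"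
    using sum_of_signs_mod_4[of "{..<t}" ?g, OF _ sg] unfolding pg by simp
  moreover have "4 dvd (\<Sum>i<t. ?h i) - (int t - 2)"
    using sum_of_signs_mod_4[of "{..<t}" ?h, OF _ sh] unfolding ph by simp
  ultimately have "4 dvd (\<Sum>i<t. ?g i) - (int t - 2) + ((\<Sum>i<t. ?h i) - (int t - 2))"
    by (rule dvd_add)
  moreover have "(\<Sum>i<t. ?g i) - (int t - 2) + ((\<Sum>i<t. ?h i) - (int t - 2)) = - 2 * int t + 4"
    using zero by simp
  ultimately show False using odd by presburger
qed

text \<open>
  If \<open>\<eta> = 1\<close>, the autocorrelations of \<open>\<alpha>\<close> and \<open>\<beta>\<close> agree, so both vanish and \<open>\<alpha>\<close> is a negacyclic
  Hadamard sequence.  If \<open>\<eta> = -1\<close>, the cross-correlation at shift \<open>t + 1\<close> is, up to the factor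
  \<open>-2 e\<close>, the sum of \<open>2 t\<close> signs \<open>(-1)\<^sup>i * \<alpha> i * \<alpha> (i + 1)\<close>, whose product is \<open>-(-1)\<^sup>t\<close>; a
  vanishing sum would need product \<open>(-1)\<^sup>t\<close>.
\<close>

lemma no_half_period_exchange:
  assumes "t \<ge> 2" and \<eta>: "\<eta> = 1 \<or> \<eta> = - 1" and e: "e = 1 \<or> e = - 1"
    and \<beta>: "\<And>i. \<beta> (i + t) = e * \<eta> ^ i * \<alpha> i"
  shows False
  using \<eta>
proof
  assume \<eta>1: "\<eta> = 1"
  have van: "(\<Sum>i<2 * t. \<alpha> i * \<alpha> (i + s)) = 0" if "0 < s" "s < 2 * t" for s
  proof -
    have "(\<Sum>i<2 * t. \<beta> i * \<beta> (i + s)) = (\<Sum>i<2 * t. \<beta> (i + t) * \<beta> (i + t + s))"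
    proof (rule sum_periodic_shift[symmetric])
      show "\<beta> (i + 2 * t) * \<beta> (i + 2 * t + s) = \<beta> i * \<beta> (i + s)" for i
        using \<beta>_neg[of i] \<beta>_neg[of "i + s"] by (simp add: ac_simps)
    qed
    moreover have "\<beta> (i + t) * \<beta> (i + t + s) = \<alpha> i * \<alpha> (i + s)" for i
      using \<beta>[of i] \<beta>[of "i + s"] e by (auto simp: \<eta>1 ac_simps)
    ultimately show ?thesis
      using auto_corr[OF that] by (simp add: sum.distrib)
  qed
  show False
    by (rule no_negacyclic_Hadamard_sequence[of \<alpha> "2 * t", OF \<alpha>_sign \<alpha>_neg])
      (use van[of 1] van[of 2] assms(1) in auto)
next
  assume \<eta>1: "\<eta> = - 1"
  have "(\<Sum>i<2 * t. \<beta> i * \<alpha> (i + (t + 1))) = (\<Sum>i<2 * t. \<beta> (i + t) * \<alpha> (i + t + (t + 1)))"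
  proof (rule sum_periodic_shift[symmetric])
    show "\<beta> (i + 2 * t) * \<alpha> (i + 2 * t + (t + 1)) = \<beta> i * \<alpha> (i + (t + 1))" for i
      using \<beta>_neg[of i] \<alpha>_neg[of "i + (t + 1)"] by (simp add: ac_simps)
  qed
  moreover have "\<beta> (i + t) * \<alpha> (i + t + (t + 1)) = - e * ((- 1) ^ i * (\<alpha> i * \<alpha> (i + 1)))" for i
  proof -
    have "i + t + (t + 1) = i + 1 + 2 * t"
      by simp
    then show ?thesis
      using \<beta>[of i] \<alpha>_neg[of "i + 1"] by (simp only: \<eta>1)
  qed
  ultimately have A: "(\<Sum>i<2 * t. \<beta> i * \<alpha> (i + (t + 1))) =
      - e * (\<Sum>i<2 * t. (- 1) ^ i * (\<alpha> i * \<alpha> (i + 1)))"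
    by (simp only: sum_distrib_left)
  have "\<alpha> i * \<beta> (i + (t + 1)) = - e * ((- 1) ^ i * (\<alpha> i * \<alpha> (i + 1)))" for i
    using \<beta>[of "i + 1"] by (simp add: \<eta>1 ac_simps)
  then have B: "(\<Sum>i<2 * t. \<alpha> i * \<beta> (i + (t + 1))) =
      - e * (\<Sum>i<2 * t. (- 1) ^ i * (\<alpha> i * \<alpha> (i + 1)))"
    by (simp only: sum_distrib_left)
  have zero: "(\<Sum>i<2 * t. (- 1) ^ i * (\<alpha> i * \<alpha> (i + 1))) = 0"
    using cross_corr[of "t + 1"] e unfolding sum.distrib A B by auto
  have "(\<Prod>i<2 * t. (- 1 :: int) ^ i) = (- 1) ^ t"
    by (induction t) simp_all
  then have p: "(\<Prod>i<2 * t. (- 1) ^ i * (\<alpha> i * \<alpha> (i + 1))) = - ((- 1) ^ t)"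
    using prod_signs_shift_1[of \<alpha> "2 * t", OF \<alpha>_sign] \<alpha>_neg[of 0] \<alpha>_sign[of 0]
    by (auto simp: prod.distrib)
  have "(- 1) ^ i * (\<alpha> i * \<alpha> (i + 1)) = 1 \<or> (- 1) ^ i * (\<alpha> i * \<alpha> (i + 1)) = - 1" for i
    using \<alpha>_sign[of i] \<alpha>_sign[of "i + 1"] by (auto simp: minus_one_power_iff)
  from sum_of_signs_mod_4[of "{..<2 * t}" "\<lambda>i. (- 1) ^ i * (\<alpha> i * \<alpha> (i + 1))", OF _ this]
  show False
    unfolding zero p by (cases "even t") (auto; presburger)+
qed

end

section \<open>Binary vectors and Hadamard codes\<close>

lemma binary_add_self: "x + x = (0 :: bit ^ 'n)"
  by (simp add: vec_eq_iff)

lemma binary_add_cancel: "x + y + y = (x :: bit ^ 'n)"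
  by (simp add: add.assoc binary_add_self)

lemma binary_add_eq_iff: "x + y = z \<longleftrightarrow> x = z + (y :: bit ^ 'n)"
  by (metis binary_add_cancel)

lemma all_one_neq_0: "all_one \<noteq> (0 :: bit ^ 'n)"
  by (simp add: all_one_def vec_eq_iff)

lemma perm_vec_0: "perm_vec p 0 = 0"
  by (simp add: perm_vec_def vec_eq_iff)

lemma perm_vec_all_one: "perm_vec p all_one = all_one"
  by (simp add: perm_vec_def all_one_def vec_eq_iff)

lemma bit_sign_all_one: "bit_sign ((x + all_one) $ j) = - bit_sign (x $ j)"
  unfolding vector_add_component bit_sign_add by (simp add: all_one_def bit_sign_def)

lemma hadamard_code_add_all_one:
  assumes "hadamard_code C" and "x \<in> C"
  shows "x + all_one \<in> C"
  using assms by (auto simp: hadamard_code_def binary_add_cancel)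

text \<open>
  Both \<open>x\<close> and \<open>0\<close> are rows or complements of rows.  The two rows are distinct, hence orthogonal,
  and the row behind \<open>0\<close> is constant.
\<close>

lemma hadamard_code_balanced:
  fixes C :: "(bit ^ 'n) set"
  assumes "hadamard_code C" and "0 \<in> C" and "x \<in> C" and "x \<notin> {0, all_one}"
  shows "(\<Sum>j\<in>UNIV. bit_sign (x $ j)) = 0"
proof -
  obtain H :: "real ^ 'n ^ 'n" where H: "hadamard_matrix H"
    and C: "C = rows (binary_matrix H) \<union> (\<lambda>r. r + all_one) ` rows (binary_matrix H)"
    using assms(1) by (auto simp: hadamard_code_def)
  let ?r = "\<lambda>i. binary_matrix H $ i"
  have rows: "\<exists>i. y = ?r i \<or> y = ?r i + all_one" if "y \<in> C" for y
    using that by (auto simp: C rows_def row_def)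
  obtain i where i: "x = ?r i \<or> x = ?r i + all_one"
    using rows[OF assms(3)] by auto
  obtain k where k: "0 = ?r k \<or> 0 = ?r k + all_one"
    using rows[OF assms(2)] by auto
  have "i \<noteq> k"
  proof
    assume "i = k"
    then have "x \<in> {0, all_one}"
      using i k by (metis add.left_neutral binary_add_eq_iff insertCI)
    then show False using assms(4) by simp
  qed
  have entry: "real_of_int (bit_sign (?r l $ j)) = H $ l $ j" for l j
    using H by (auto simp: hadamard_matrix_def binary_matrix_def bit_sign_def)
  have "(H ** transpose H) $ i $ k = 0"
    using H \<open>i \<noteq> k\<close> by (simp add: hadamard_matrix_def mat_def)
  then have "(\<Sum>j\<in>UNIV. H $ i $ j * H $ k $ j) = 0"
    by (simp add: matrix_matrix_mult_def transpose_def)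
  then have "real_of_int (\<Sum>j\<in>UNIV. bit_sign (?r i $ j) * bit_sign (?r k $ j)) = 0"
    by (simp add: entry)
  then have orth: "(\<Sum>j\<in>UNIV. bit_sign (?r i $ j) * bit_sign (?r k $ j)) = 0"
    by (simp only: of_int_eq_0_iff)
  have "\<exists>d. (d = 1 \<or> d = - 1) \<and> (\<forall>j. bit_sign (?r k $ j) = d)"
  proof (cases "?r k = 0")
    case True
    then show ?thesis by (simp add: bit_sign_def)
  next
    case False
    then have "?r k = 0 + all_one"
      using k by (metis binary_add_cancel)
    then show ?thesis by (simp add: all_one_def bit_sign_def)
  qed
  then obtain d where "d = 1 \<or> d = - 1" "\<And>j. bit_sign (?r k $ j) = d"
    by auto
  then have "(\<Sum>j\<in>UNIV. bit_sign (?r i $ j)) = 0"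
    using orth by (auto simp: sum_negf)
  then show ?thesis
    using i by (auto simp: bit_sign_all_one sum_negf simp del: vector_add_component)
qed

text \<open>
  Equality modulo the subgroup \<open>{0, all_one}\<close>, which acts trivially on the coordinates.
\<close>

definition equal_or_complement :: "bit ^ 'n \<Rightarrow> bit ^ 'n \<Rightarrow> bool" (infix \<open>\<approx>\<close> 50) where
  "x \<approx> y \<longleftrightarrow> y = x \<or> y = x + all_one"

lemma equal_or_complement_refl: "x \<approx> x"
  by (simp add: equal_or_complement_def)

lemma equal_or_complement_sym: "x \<approx> y \<Longrightarrow> y \<approx> x"
  by (auto simp: equal_or_complement_def binary_add_cancel)

lemma equal_or_complement_trans: "x \<approx> y \<Longrightarrow> y \<approx> z \<Longrightarrow> x \<approx> z"
  by (auto simp: equal_or_complement_def binary_add_cancel)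

lemma equal_or_complement_perm_vec: "x \<approx> y \<Longrightarrow> perm_vec p x \<approx> perm_vec p y"
  by (auto simp: equal_or_complement_def perm_vec_add perm_vec_all_one)

lemma equal_or_complement_0: "0 \<approx> x \<longleftrightarrow> x \<in> {0, all_one}"
  by (auto simp: equal_or_complement_def)

lemma equal_or_complement_iff_add: "x \<approx> y \<longleftrightarrow> 0 \<approx> x + y"
proof -
  have "x + y = 0 \<longleftrightarrow> y = x" and "x + y = all_one \<longleftrightarrow> y = x + all_one"
    by (metis add.commute add.left_neutral binary_add_eq_iff)+
  then show ?thesis by (simp add: equal_or_complement_def)
qed

lemma card_binary_span:
  fixes B :: "(bit ^ 'n) set"
  assumes "finite B"
  shows "finite (vec.span B) \<and> (\<exists>k. card (vec.span B) = 2 ^ k)"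
  using assms
proof (induction B rule: finite_induct)
  case empty
  show ?case by (auto intro: exI[of _ 0])
next
  case (insert x B)
  then obtain k where k: "card (vec.span B) = 2 ^ k" and fin: "finite (vec.span B)"
    by auto
  let ?S = "vec.span B"
  show ?case
  proof (cases "x \<in> ?S")
    case True
    then show ?thesis using k fin by (metis vec.span_redundant)
  next
    case False
    have bit: "c = 0 \<or> c = 1" for c :: bit
      by (cases c) simp_all
    have "vec.span (insert x B) = ?S \<union> (\<lambda>y. y + x) ` ?S"
    proof (intro equalityI subsetI)
      fix y assume "y \<in> vec.span (insert x B)"
      then obtain c where c: "y - c *s x \<in> ?S"
        by (auto simp: vec.span_insert)
      show "y \<in> ?S \<union> (\<lambda>y. y + x) ` ?S"
      proof (cases "c = 0")
        case True
        then show ?thesis using c by simp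
      next
        case False
        then have "y - x \<in> ?S" using c bit[of c] by simp
        moreover have "y = (y - x) + x" by simp
        ultimately show ?thesis by blast
      qed
    next
      fix y assume "y \<in> ?S \<union> (\<lambda>y. y + x) ` ?S"
      then show "y \<in> vec.span (insert x B)"
        by (auto intro: vec.span_add vec.span_base subsetD[OF vec.span_mono[of B "insert x B"]])
    qed
    moreover have "?S \<inter> (\<lambda>y. y + x) ` ?S = {}"
    proof (rule ccontr)
      assume "?S \<inter> (\<lambda>y. y + x) ` ?S \<noteq> {}"
      then obtain y where "y \<in> ?S" "y + x \<in> ?S" by auto
      then have "(y + x) - y \<in> ?S" by (intro vec.span_diff)
      then show False using False by simp
    qed
    moreover have "card ((\<lambda>y. y + x) ` ?S) = 2 ^ k"
      using k by (subst card_image) (auto simp: inj_on_def)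
    ultimately have "finite (vec.span (insert x B))" "card (vec.span (insert x B)) = 2 ^ Suc k"
      using fin k by (simp_all add: card_Un_disjoint)
    then show ?thesis by blast
  qed
qed

lemma card_binary_subspace:
  fixes V :: "(bit ^ 'n) set"
  assumes "vec.subspace V" "finite V"
  shows "\<exists>k. card V = 2 ^ k"
  using card_binary_span[OF assms(2)] by (simp only: vec.span_eq_iff[THEN iffD2, OF assms(1)])

section \<open>Full propelinear Hadamard codes and their kernels\<close>

locale hfp =
  fixes C :: "(bit ^ 'n) set" and \<pi> :: "bit ^ 'n \<Rightarrow> 'n \<Rightarrow> 'n"
  assumes hfp_code: "hfp_code C \<pi>"
begin

abbreviation G :: "(bit ^ 'n) monoid" where
  "G \<equiv> propelinear_group C \<pi>"

abbreviation act :: "bit ^ 'n \<Rightarrow> bit ^ 'n \<Rightarrow> bit ^ 'n" where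
  "act g \<equiv> perm_vec (\<pi> g)"

lemma carrier_G [simp]: "carrier G = C"
  by (simp add: propelinear_group_def)

lemma one_G: "\<one>\<^bsub>G\<^esub> = 0"
  by (simp add: propelinear_group_def)

lemma mult_G: "x \<otimes>\<^bsub>G\<^esub> y = x + act x y"
  by (simp add: propelinear_group_def)

lemma zero_in_C: "0 \<in> C"
  using hfp_code by (simp add: hfp_code_def)

lemma hadamard: "hadamard_code C"
  using hfp_code by (simp add: hfp_code_def)

lemma finite_C: "finite C"
proof -
  obtain H :: "real ^ 'n ^ 'n" where
    "C = rows (binary_matrix H) \<union> (\<lambda>r. r + all_one) ` rows (binary_matrix H)"
    using hadamard by (auto simp: hadamard_code_def)
  moreover have "finite (rows (binary_matrix H))"
    by (simp add: rows_def full_SetCompr_eq)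
  ultimately show ?thesis by simp
qed

lemma add_all_one_in_C: "x \<in> C \<Longrightarrow> x + all_one \<in> C"
  by (rule hadamard_code_add_all_one[OF hadamard])

lemma all_one_in_C: "all_one \<in> C"
  using add_all_one_in_C[OF zero_in_C] by simp

lemma propelinear: "propelinear C \<pi>"
  using hfp_code by (simp add: hfp_code_def)

sublocale group G
  by (rule group_propelinear_group[OF propelinear zero_in_C finite_C])

lemma permutes: "x \<in> C \<Longrightarrow> \<pi> x permutes UNIV"
  using propelinear by (auto simp: propelinear_def)

lemma pi_mult: "x \<in> C \<Longrightarrow> y \<in> C \<Longrightarrow> \<pi> (x \<otimes>\<^bsub>G\<^esub> y) = \<pi> x \<circ> \<pi> y"
  using propelinear by (auto simp: propelinear_def mult_G)

lemma act_act: "x \<in> C \<Longrightarrow> y \<in> C \<Longrightarrow> act x (act y z) = act (x \<otimes>\<^bsub>G\<^esub> y) z"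
  by (simp add: pi_mult perm_vec_comp[OF permutes permutes])

lemma act_0: "act 0 z = z"
  using hfp_code by (simp add: hfp_code_def perm_vec_def vec_eq_iff)

lemma act_inv: "g \<in> C \<Longrightarrow> act (inv\<^bsub>G\<^esub> g) (act g z) = z"
  using inv_closed[of g] by (simp add: act_act act_0 one_G)

lemma mult_all_one: "x \<otimes>\<^bsub>G\<^esub> all_one = x + all_one"
  by (simp add: mult_G perm_vec_all_one)

lemma fixed_point_imp_trivial:
  assumes "x \<in> C" "\<pi> x i = i"
  shows "x \<in> {0, all_one}"
  using hfp_code assms by (auto simp: hfp_code_def)

lemma square_trivial_iff: "x \<otimes>\<^bsub>G\<^esub> x \<in> {0, all_one} \<longleftrightarrow> x \<approx> act x x"
  by (simp add: mult_G equal_or_complement_iff_add[of x] equal_or_complement_0)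

lemma mem_kernel_iff: "z \<in> code_kernel C \<longleftrightarrow> (\<forall>x\<in>C. x + z \<in> C)"
proof
  show "\<forall>x\<in>C. x + z \<in> C" if "z \<in> code_kernel C"
    using that by (auto simp: code_kernel_def)
next
  assume *: "\<forall>x\<in>C. x + z \<in> C"
  have "x \<in> (\<lambda>x. x + z) ` C" if "x \<in> C" for x
    using * that binary_add_cancel[of x z] by (intro image_eqI[of _ _ "x + z"]) auto
  then show "z \<in> code_kernel C"
    using * by (auto simp: code_kernel_def)
qed

lemma kernel_subset: "z \<in> code_kernel C \<Longrightarrow> z \<in> C"
  using zero_in_C by (force simp: mem_kernel_iff)

lemma kernel_add: "x \<in> code_kernel C \<Longrightarrow> y \<in> code_kernel C \<Longrightarrow> x + y \<in> code_kernel C"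
  by (auto simp: mem_kernel_iff add.assoc[symmetric])

lemma zero_in_kernel: "0 \<in> code_kernel C"
  by (simp add: mem_kernel_iff)

lemma all_one_in_kernel: "all_one \<in> code_kernel C"
  by (simp add: mem_kernel_iff add_all_one_in_C)

lemma kernel_equal_or_complement: "x \<in> code_kernel C \<Longrightarrow> x \<approx> y \<Longrightarrow> y \<in> code_kernel C"
  by (auto simp: equal_or_complement_def kernel_add all_one_in_kernel)

text \<open>
  Left multiplication by \<open>g\<close> permutes \<open>C\<close>, so each \<open>y \<in> C\<close> is \<open>g x\<close> with \<open>x \<in> C\<close>, and then
  \<open>y + act g z = g (x + z)\<close>.
\<close>

lemma kernel_act:
  assumes "z \<in> code_kernel C" "g \<in> C"
  shows "act g z \<in> code_kernel C"
  unfolding mem_kernel_iff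
proof
  fix y assume y: "y \<in> C"
  define x where "x = inv\<^bsub>G\<^esub> g \<otimes>\<^bsub>G\<^esub> y"
  have x: "x \<in> C" using assms(2) y m_closed[of "inv\<^bsub>G\<^esub> g" y] inv_closed[of g] by (simp add: x_def)
  have "y = g \<otimes>\<^bsub>G\<^esub> x"
    using assms(2) y inv_closed[of g] by (simp add: x_def m_assoc[symmetric])
  then have "y + act g z = g \<otimes>\<^bsub>G\<^esub> (x + z)"
    by (simp add: mult_G perm_vec_add add.assoc)
  then show "y + act g z \<in> C"
    using assms x m_closed[of g "x + z"] by (auto simp: mem_kernel_iff)
qed

lemma kernel_mult:
  "x \<in> code_kernel C \<Longrightarrow> y \<in> code_kernel C \<Longrightarrow> x \<otimes>\<^bsub>G\<^esub> y \<in> code_kernel C"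
  by (simp add: mult_G kernel_add kernel_act kernel_subset)

lemma kernel_subgroup: "subgroup (code_kernel C) G"
proof (rule subgroupI)
  show "code_kernel C \<subseteq> carrier G" using kernel_subset by auto
  show "code_kernel C \<noteq> {}" using zero_in_kernel by auto
  show "inv\<^bsub>G\<^esub> x \<in> code_kernel C" if "x \<in> code_kernel C" for x
  proof -
    have "x \<in> C" using that by (rule kernel_subset)
    then have "inv\<^bsub>G\<^esub> x + act (inv\<^bsub>G\<^esub> x) x = 0"
      using l_inv[of x] by (simp add: mult_G one_G)
    then have "inv\<^bsub>G\<^esub> x = act (inv\<^bsub>G\<^esub> x) x"
      by (simp add: binary_add_eq_iff)
    moreover have "act (inv\<^bsub>G\<^esub> x) x \<in> code_kernel C"
      using that \<open>x \<in> C\<close> inv_closed[of x] by (intro kernel_act) auto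
    ultimately show ?thesis by simp
  qed
qed (rule kernel_mult)

lemma kernel_subspace: "vec.subspace (code_kernel C)"
proof -
  have bit: "c = 0 \<or> c = 1" for c :: bit
    by (cases c) simp_all
  have "c *s x \<in> code_kernel C" if "x \<in> code_kernel C" for c x
    using bit[of c] that zero_in_kernel by auto
  then show ?thesis
    by (simp add: vec.subspace_def zero_in_kernel kernel_add)
qed

text \<open>
  The kernel carries two group structures: as a binary linear space it has \<open>2\<^sup>k\<close> elements, and
  Lagrange's theorem for the other structure, a subgroup of \<open>G\<close>, makes all orders powers of two.
\<close>

lemma kernel_element_power_of_two_order:
  assumes "x \<in> code_kernel C"
  shows "\<exists>k. x [^]\<^bsub>G\<^esub> ((2::nat) ^ k) = 0"
proof -
  have "finite (code_kernel C)"
    using finite_C kernel_subset by (meson finite_subset subsetI)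
  then obtain k where k: "card (code_kernel C) = 2 ^ k"
    using card_binary_subspace[OF kernel_subspace] by auto
  interpret K: group "G\<lparr>carrier := code_kernel C\<rparr>"
    by (rule subgroup_imp_group[OF kernel_subgroup])
  have "x [^]\<^bsub>G\<^esub> (2 ^ k :: nat) = 0"
    using K.pow_order_eq_1[of x] assms k
    by (simp add: order_def nat_pow_consistent[symmetric] one_G)
  then show ?thesis ..
qed

text \<open>
  The last term outside \<open>{0, all_one}\<close> in the sequence of repeated squares of \<open>x\<close>.
\<close>

lemma nontrivial_kernel_imp_involution:
  assumes "x \<in> code_kernel C" "x \<notin> {0, all_one}"
  shows "\<exists>z \<in> code_kernel C. z \<notin> {0, all_one} \<and> z \<otimes>\<^bsub>G\<^esub> z \<in> {0, all_one}"
proof -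
  let ?p = "\<lambda>k. x [^]\<^bsub>G\<^esub> ((2::nat) ^ k)"
  have x: "x \<in> C" by (rule kernel_subset) fact
  define m where "m = (LEAST k. ?p k \<in> {0, all_one})"
  obtain k where "?p k = 0"
    using kernel_element_power_of_two_order[OF assms(1)] by auto
  then have "?p k \<in> {0, all_one}" by blast
  then have m: "?p m \<in> {0, all_one}"
    unfolding m_def by (rule LeastI)
  have "m \<noteq> 0"
    using m assms(2) x by (intro notI) simp
  then obtain l where l: "m = Suc l" by (cases m) auto
  have "?p l \<notin> {0, all_one}"
    using not_less_Least[of l "\<lambda>k. ?p k \<in> {0, all_one}"] unfolding m_def[symmetric] l by blast
  moreover have "?p l \<otimes>\<^bsub>G\<^esub> ?p l = ?p m"
    using x by (simp add: nat_pow_mult l mult_2)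
  moreover have "?p l \<in> code_kernel C"
  proof -
    have "x [^]\<^bsub>G\<^esub> (n::nat) \<in> code_kernel C" for n
      by (induction n) (simp_all add: one_G zero_in_kernel kernel_mult assms(1))
    then show ?thesis by simp
  qed
  ultimately show ?thesis
    using m by (intro bexI[of _ "?p l"] conjI) (simp_all only: not_False_eq_True)
qed

end

section \<open>The group generated by a and b\<close>

locale hfp_4tu_2 = hfp C \<pi> for C :: "(bit ^ 'n) set" and \<pi> +
  fixes t :: nat and a b :: "bit ^ 'n"
  assumes length: "CARD('n) = 4 * t"
    and a_in_C: "a \<in> C" and b_in_C: "b \<in> C"
    and product: "(\<lambda>(x, y). x \<otimes>\<^bsub>G\<^esub> y) \<in>
      iso (subgroup_generated G {a} \<times>\<times> subgroup_generated G {b}) G"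
    and ord_a: "ord a = 4 * t" and ord_b: "ord b = 2"
    and a_pow_2t: "a [^]\<^bsub>G\<^esub> (2 * t) = all_one"
begin

abbreviation pow_a :: "nat \<Rightarrow> bit ^ 'n" where
  "pow_a i \<equiv> a [^]\<^bsub>G\<^esub> i"

lemma t_pos: "t > 0"
  using length zero_less_card_finite[where 'a = 'n] by (cases t) auto

lemma pow_a_in_C: "pow_a i \<in> C"
  using nat_pow_closed[of a i] a_in_C by simp

lemma b_square: "b \<otimes>\<^bsub>G\<^esub> b = 0"
  using pow_ord_eq_1[of b] b_in_C by (simp add: ord_b one_G[symmetric] numeral_2_eq_2)

lemma b_neq_0: "b \<noteq> 0"
  using ord_b ord_id by (auto simp: one_G)

text \<open>
  That this holds for all elements of the two factors makes the factors, and hence \<open>G\<close>, commutative.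
\<close>

lemma product_hom:
  assumes "x \<in> carrier (subgroup_generated G {a})" "x' \<in> carrier (subgroup_generated G {a})"
    and "y \<in> carrier (subgroup_generated G {b})" "y' \<in> carrier (subgroup_generated G {b})"
  shows "(x \<otimes>\<^bsub>G\<^esub> x') \<otimes>\<^bsub>G\<^esub> (y \<otimes>\<^bsub>G\<^esub> y') = (x \<otimes>\<^bsub>G\<^esub> y) \<otimes>\<^bsub>G\<^esub> (x' \<otimes>\<^bsub>G\<^esub> y')"
proof -
  have "\<forall>x\<in>carrier (subgroup_generated G {a}). \<forall>y\<in>carrier (subgroup_generated G {b}).
      \<forall>x'\<in>carrier (subgroup_generated G {a}). \<forall>y'\<in>carrier (subgroup_generated G {b}).
        (x \<otimes>\<^bsub>G\<^esub> x') \<otimes>\<^bsub>G\<^esub> (y \<otimes>\<^bsub>G\<^esub> y') = (x \<otimes>\<^bsub>G\<^esub> y) \<otimes>\<^bsub>G\<^esub> (x' \<otimes>\<^bsub>G\<^esub> y')"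
    using product by (simp add: iso_def hom_def mult_DirProd')
  then show ?thesis using assms by blast
qed

lemma product_inj:
  assumes "x \<in> carrier (subgroup_generated G {a})" "x' \<in> carrier (subgroup_generated G {a})"
    and "y \<in> carrier (subgroup_generated G {b})" "y' \<in> carrier (subgroup_generated G {b})"
    and "x \<otimes>\<^bsub>G\<^esub> y = x' \<otimes>\<^bsub>G\<^esub> y'"
  shows "x = x' \<and> y = y'"
  using product assms by (auto simp: iso_def bij_betw_def inj_on_def)

lemma cyclic_a: "carrier (subgroup_generated G {a}) = range pow_a"
proof -
  have "a [^]\<^bsub>G\<^esub> (i :: int) \<in> range pow_a" for i
  proof -
    have "int (nat (i mod int (4 * t))) = i mod int (4 * t)"
      using t_pos by simp
    moreover have "int (4 * t) dvd i mod int (4 * t) - i"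
      by (simp add: mod_eq_dvd_iff[symmetric])
    ultimately have "a [^]\<^bsub>G\<^esub> i = a [^]\<^bsub>G\<^esub> int (nat (i mod int (4 * t)))"
      using int_pow_eq[of a i "int (nat (i mod int (4 * t)))"] a_in_C ord_a by simp
    then show ?thesis by (simp only: int_pow_int rangeI)
  qed
  moreover have "pow_a i = a [^]\<^bsub>G\<^esub> (int i)" for i
    by (simp add: int_pow_int)
  ultimately show ?thesis
    using a_in_C by (auto simp: carrier_subgroup_generated_by_singleton)
qed

lemma cyclic_b: "carrier (subgroup_generated G {b}) = {0, b}"
proof -
  have "b [^]\<^bsub>G\<^esub> (i :: int) \<in> {0, b}" for i
  proof -
    have "b [^]\<^bsub>G\<^esub> i = b [^]\<^bsub>G\<^esub> (i mod 2)"
      using int_pow_eq[of b i "i mod 2"] b_in_C ord_b by simp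
    moreover have "i mod 2 = 0 \<or> i mod 2 = 1" by presburger
    ultimately show ?thesis using b_in_C by (auto simp: one_G)
  qed
  moreover have "0 \<in> range (\<lambda>i :: int. b [^]\<^bsub>G\<^esub> i)"
    using b_in_C by (intro range_eqI[of _ _ 0]) (simp add: one_G)
  moreover have "b \<in> range (\<lambda>i :: int. b [^]\<^bsub>G\<^esub> i)"
    using b_in_C by (intro range_eqI[of _ _ 1]) simp
  ultimately show ?thesis
    using b_in_C by (auto simp: carrier_subgroup_generated_by_singleton)
qed

lemma zero_mult: "x \<in> C \<Longrightarrow> 0 \<otimes>\<^bsub>G\<^esub> x = x"
  using l_one[of x] by (simp add: one_G)

lemma mult_zero: "x \<in> C \<Longrightarrow> x \<otimes>\<^bsub>G\<^esub> 0 = x"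
  using r_one[of x] by (simp add: one_G)

lemma C_cases:
  assumes "x \<in> C"
  obtains i where "x = pow_a i" | i where "x = pow_a i \<otimes>\<^bsub>G\<^esub> b"
proof -
  have "x \<in> (\<lambda>(x, y). x \<otimes>\<^bsub>G\<^esub> y) ` (range pow_a \<times> {0, b})"
    using product assms by (simp add: iso_def bij_betw_def cyclic_a cyclic_b)
  then show thesis
    using that pow_a_in_C by (auto simp: mult_zero)
qed

lemma pow_a_0: "pow_a 0 = 0"
  by (simp add: one_G)

lemma b_commutes: "b \<otimes>\<^bsub>G\<^esub> pow_a i = pow_a i \<otimes>\<^bsub>G\<^esub> b"
proof -
  have "0 \<in> carrier (subgroup_generated G {a})"
    unfolding cyclic_a using pow_a_0 by (metis rangeI)
  then show ?thesis
    using product_hom[of 0 "pow_a i" b 0] pow_a_in_C b_in_C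
    by (simp add: cyclic_a cyclic_b zero_mult mult_zero)
qed

lemma mult_in_C: "x \<in> C \<Longrightarrow> y \<in> C \<Longrightarrow> x \<otimes>\<^bsub>G\<^esub> y \<in> C"
  using m_closed[of x y] by simp

lemma mult_assoc:
  "x \<in> C \<Longrightarrow> y \<in> C \<Longrightarrow> z \<in> C \<Longrightarrow> (x \<otimes>\<^bsub>G\<^esub> y) \<otimes>\<^bsub>G\<^esub> z = x \<otimes>\<^bsub>G\<^esub> (y \<otimes>\<^bsub>G\<^esub> z)"
  using m_assoc[of x y z] by simp

lemma pow_a_commutes: "x \<in> C \<Longrightarrow> pow_a i \<otimes>\<^bsub>G\<^esub> x = x \<otimes>\<^bsub>G\<^esub> pow_a i"
proof (erule C_cases)
  fix j
  have comm: "pow_a i \<otimes>\<^bsub>G\<^esub> pow_a j = pow_a j \<otimes>\<^bsub>G\<^esub> pow_a i" for j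
    using a_in_C by (simp add: nat_pow_mult add.commute)
  show "pow_a i \<otimes>\<^bsub>G\<^esub> x = x \<otimes>\<^bsub>G\<^esub> pow_a i" if "x = pow_a j"
    using that comm by simp
  show "pow_a i \<otimes>\<^bsub>G\<^esub> x = x \<otimes>\<^bsub>G\<^esub> pow_a i" if x: "x = pow_a j \<otimes>\<^bsub>G\<^esub> b"
  proof -
    have "pow_a i \<otimes>\<^bsub>G\<^esub> x = (pow_a j \<otimes>\<^bsub>G\<^esub> pow_a i) \<otimes>\<^bsub>G\<^esub> b"
      unfolding x comm[symmetric] by (simp add: mult_assoc pow_a_in_C b_in_C)
    then show ?thesis
      unfolding x by (simp add: mult_assoc pow_a_in_C b_in_C b_commutes)
  qed
qed

lemma mult_commute:
  assumes "x \<in> C" "y \<in> C"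
  shows "x \<otimes>\<^bsub>G\<^esub> y = y \<otimes>\<^bsub>G\<^esub> x"
proof -
  have b: "b \<otimes>\<^bsub>G\<^esub> y = y \<otimes>\<^bsub>G\<^esub> b"
    using assms(2)
  proof (rule C_cases)
    show "b \<otimes>\<^bsub>G\<^esub> y = y \<otimes>\<^bsub>G\<^esub> b" if "y = pow_a j" for j
      using that b_commutes by simp
    show "b \<otimes>\<^bsub>G\<^esub> y = y \<otimes>\<^bsub>G\<^esub> b" if "y = pow_a j \<otimes>\<^bsub>G\<^esub> b" for j
      using that pow_a_commutes[of b j] pow_a_commutes[of "b \<otimes>\<^bsub>G\<^esub> b" j]
      by (simp add: mult_assoc mult_in_C pow_a_in_C b_in_C)
  qed
  show ?thesis
    using assms(1)
  proof (rule C_cases)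
    show "x \<otimes>\<^bsub>G\<^esub> y = y \<otimes>\<^bsub>G\<^esub> x" if "x = pow_a i" for i
      using that pow_a_commutes assms(2) by simp
    show "x \<otimes>\<^bsub>G\<^esub> y = y \<otimes>\<^bsub>G\<^esub> x" if x: "x = pow_a i \<otimes>\<^bsub>G\<^esub> b" for i
    proof -
      have "x \<otimes>\<^bsub>G\<^esub> y = (pow_a i \<otimes>\<^bsub>G\<^esub> y) \<otimes>\<^bsub>G\<^esub> b"
        unfolding x by (simp add: mult_assoc pow_a_in_C b_in_C assms(2) b)
      then show ?thesis
        unfolding x by (simp add: pow_a_commutes mult_assoc pow_a_in_C b_in_C assms(2))
    qed
  qed
qed

lemma mult_left_commute:
  "x \<in> C \<Longrightarrow> y \<in> C \<Longrightarrow> z \<in> C \<Longrightarrow> x \<otimes>\<^bsub>G\<^esub> (y \<otimes>\<^bsub>G\<^esub> z) = y \<otimes>\<^bsub>G\<^esub> (x \<otimes>\<^bsub>G\<^esub> z)"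
  using mult_commute[of x y] by (simp flip: mult_assoc)

lemma all_one_mult: "x \<in> C \<Longrightarrow> all_one \<otimes>\<^bsub>G\<^esub> x = x + all_one"
  using mult_commute[of all_one x] all_one_in_C by (simp add: mult_all_one)

lemma act_commute: "g \<in> C \<Longrightarrow> h \<in> C \<Longrightarrow> act g (act h x) = act h (act g x)"
  using mult_commute[of g h] by (simp add: act_act)

lemma equal_or_complement_mult:
  assumes "x \<in> C" "z \<in> C" "x \<approx> y"
  shows "x \<otimes>\<^bsub>G\<^esub> z \<approx> y \<otimes>\<^bsub>G\<^esub> z"
proof -
  have "(x + all_one) \<otimes>\<^bsub>G\<^esub> z = x \<otimes>\<^bsub>G\<^esub> z + all_one"
    using assms all_one_in_C mult_assoc[of all_one x z]
    by (simp add: all_one_mult[symmetric] mult_in_C)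
  then show ?thesis using assms(3) by (auto simp: equal_or_complement_def)
qed

lemma pow_a_add_2t: "pow_a (i + 2 * t) = pow_a i + all_one"
  using a_in_C by (simp add: nat_pow_mult[symmetric] a_pow_2t mult_all_one)

lemma pow_a_trivial_iff: "0 \<approx> pow_a s \<longleftrightarrow> 2 * t dvd s"
proof -
  have iff: "pow_a i = 0 \<longleftrightarrow> 4 * t dvd i" for i
    using pow_eq_id[of a i] a_in_C by (simp add: one_G ord_a)
  have "pow_a s = all_one \<longleftrightarrow> pow_a (s + 2 * t) = 0"
    by (simp only: pow_a_add_2t binary_add_eq_iff add.left_neutral)
  then have "0 \<approx> pow_a s \<longleftrightarrow> 4 * t dvd s \<or> 4 * t dvd s + 2 * t"
    by (simp add: equal_or_complement_0 iff)
  also have "\<dots> \<longleftrightarrow> 2 * t dvd s"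
  proof
    assume "4 * t dvd s \<or> 4 * t dvd s + 2 * t"
    moreover have "2 * t dvd 4 * t"
      by (rule mult_dvd_mono) simp_all
    ultimately have "2 * t dvd s \<or> 2 * t dvd s + 2 * t"
      by (blast intro: dvd_trans)
    then show "2 * t dvd s" by simp
  next
    assume "2 * t dvd s"
    then obtain k where k: "s = 2 * t * k" by auto
    show "4 * t dvd s \<or> 4 * t dvd s + 2 * t"
    proof (cases "even k")
      case True
      then show ?thesis using k by (auto elim!: evenE)
    next
      case False
      then obtain l where "k = 2 * l + 1" by (auto elim!: oddE)
      then have "s + 2 * t = 4 * t * (l + 1)" using k by (simp add: algebra_simps)
      then show ?thesis by (metis dvd_triv_left)
    qed
  qed
  finally show ?thesis .
qed

lemma pow_a_neq_pow_a_mult_b: "pow_a i \<noteq> pow_a j \<otimes>\<^bsub>G\<^esub> b"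
proof
  assume "pow_a i = pow_a j \<otimes>\<^bsub>G\<^esub> b"
  then have "pow_a i \<otimes>\<^bsub>G\<^esub> 0 = pow_a j \<otimes>\<^bsub>G\<^esub> b"
    using mult_zero[OF pow_a_in_C, of i] by metis
  then have "0 = b"
    using product_inj[of "pow_a i" "pow_a j" 0 b] by (auto simp: cyclic_a cyclic_b)
  then show False using b_neq_0 by simp
qed

lemma pow_a_not_approx_pow_a_mult_b: "\<not> pow_a i \<approx> pow_a j \<otimes>\<^bsub>G\<^esub> b"
  using pow_a_neq_pow_a_mult_b[of i j] pow_a_neq_pow_a_mult_b[of "i + 2 * t" j]
  unfolding equal_or_complement_def pow_a_add_2t by metis

lemma pow_a_approx_iff: "i \<le> j \<Longrightarrow> pow_a i \<approx> pow_a j \<longleftrightarrow> 2 * t dvd j - i"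
proof -
  assume "i \<le> j"
  then have "pow_a j = pow_a i \<otimes>\<^bsub>G\<^esub> pow_a (j - i)"
    using a_in_C by (simp add: nat_pow_mult)
  also have "\<dots> = pow_a i + act (pow_a i) (pow_a (j - i))"
    by (rule mult_G)
  finally have "pow_a i \<approx> pow_a j \<longleftrightarrow> 0 \<approx> act (pow_a i) (pow_a (j - i))"
    unfolding equal_or_complement_iff_add[of "pow_a i"]
    by (simp add: add.assoc[symmetric] binary_add_self)
  also have "\<dots> \<longleftrightarrow> 0 \<approx> pow_a (j - i)"
    using equal_or_complement_perm_vec[of 0 "pow_a (j - i)" "\<pi> (pow_a i)"]
      equal_or_complement_perm_vec[of 0 "act (pow_a i) (pow_a (j - i))" "\<pi> (inv\<^bsub>G\<^esub> (pow_a i))"]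
      act_inv[OF pow_a_in_C]
    by (auto simp: perm_vec_0)
  finally show ?thesis by (simp add: pow_a_trivial_iff)
qed

text \<open>
  A square root of \<open>all_one\<close> in \<open>\<langle>a\<rangle>\<close>; the other one is its complement.
\<close>

definition q :: "bit ^ 'n" where
  "q = pow_a t"

lemma q_in_C: "q \<in> C"
  by (simp add: q_def pow_a_in_C)

lemma q_square: "q \<otimes>\<^bsub>G\<^esub> q = all_one"
  using a_in_C a_pow_2t by (simp add: q_def nat_pow_mult mult_2)

lemma square_pow_a_trivial:
  assumes "2 * t dvd 2 * i"
  shows "0 \<approx> pow_a i \<or> q \<approx> pow_a i"
proof -
  obtain k where k: "i = t * k" using assms by auto
  show ?thesis
  proof (cases "even k")
    case True
    then show ?thesis using k by (auto simp: pow_a_trivial_iff elim!: evenE)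
  next
    case False
    then obtain l where "k = 2 * l + 1" by (auto elim!: oddE)
    then have "t \<le> i" "i - t = 2 * t * l" using k by (auto simp: algebra_simps)
    then show ?thesis by (simp add: q_def pow_a_approx_iff)
  qed
qed

text \<open>
  These are the three involutions of \<open>G\<close> modulo \<open>all_one\<close>, a group isomorphic to \<open>C\<^sub>2\<^sub>t \<times> C\<^sub>2\<close>.
\<close>

lemma trivial_square_cases:
  assumes "z \<in> C" "z \<otimes>\<^bsub>G\<^esub> z \<in> {0, all_one}" "z \<notin> {0, all_one}"
  shows "b \<approx> z \<or> q \<approx> z \<or> q \<otimes>\<^bsub>G\<^esub> b \<approx> z"
  using assms(1)
proof (rule C_cases)
  fix i assume z: "z = pow_a i"
  have "z \<otimes>\<^bsub>G\<^esub> z = pow_a (2 * i)"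
    using a_in_C by (simp add: z nat_pow_mult mult_2)
  then have "2 * t dvd 2 * i"
    using assms(2) by (simp only: pow_a_trivial_iff[symmetric] equal_or_complement_0)
  then show ?thesis
    using square_pow_a_trivial[of i] assms(3) by (simp add: z equal_or_complement_0)
next
  fix i assume z: "z = pow_a i \<otimes>\<^bsub>G\<^esub> b"
  have "z \<otimes>\<^bsub>G\<^esub> z = (pow_a i \<otimes>\<^bsub>G\<^esub> pow_a i) \<otimes>\<^bsub>G\<^esub> (b \<otimes>\<^bsub>G\<^esub> b)"
    using pow_a_in_C[of i] b_in_C
    by (simp add: z mult_assoc mult_in_C mult_left_commute)
  then have "z \<otimes>\<^bsub>G\<^esub> z = pow_a (2 * i)"
    using a_in_C pow_a_in_C by (simp add: b_square nat_pow_mult mult_2 mult_zero)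
  then have "2 * t dvd 2 * i"
    using assms(2) by (simp only: pow_a_trivial_iff[symmetric] equal_or_complement_0)
  then have "0 \<approx> pow_a i \<or> q \<approx> pow_a i"
    by (rule square_pow_a_trivial)
  then have "0 \<otimes>\<^bsub>G\<^esub> b \<approx> z \<or> q \<otimes>\<^bsub>G\<^esub> b \<approx> z"
    unfolding z using equal_or_complement_mult[OF zero_in_C b_in_C] equal_or_complement_mult[OF q_in_C b_in_C]
    by blast
  then show ?thesis by (auto simp: zero_mult b_in_C)
qed

section \<open>A kernel element stable under the permutation of the generator\<close>

text \<open>
  For \<open>w = act g z\<close> commutativity of \<open>G\<close> reads \<open>z + act z w = w + act w z\<close>.  The permutations of \<open>g\<close>
  and \<open>z\<close> commute, so \<open>z\<close> fixes \<open>w\<close> up to complement as it does \<open>z\<close>; hence \<open>w\<close> fixes \<open>z\<close>, and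
  therefore its translate \<open>w\<close>, up to complement.
\<close>

lemma translate_of_involution:
  assumes z: "z \<in> code_kernel C" "z \<otimes>\<^bsub>G\<^esub> z \<in> {0, all_one}" and g: "g \<in> C"
  shows "act g z \<otimes>\<^bsub>G\<^esub> act g z \<in> {0, all_one}"
proof -
  define w where "w = act g z"
  have zC: "z \<in> C" and wC: "w \<in> C"
    using z(1) g by (auto simp: w_def intro: kernel_subset kernel_act)
  have "z \<approx> act z z"
    using z(2) by (simp only: square_trivial_iff)
  then have zw: "w \<approx> act z w"
    using equal_or_complement_perm_vec[of z "act z z" "\<pi> g"]
    by (simp add: w_def act_commute[OF zC g])
  have "z + act z w = w + act w z"
    using mult_commute[OF zC wC] by (simp only: mult_G)
  then have "z + act w z = w + act z w"
    by (metis add.commute add.left_commute binary_add_cancel)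
  then have "z \<approx> act w z"
    using zw equal_or_complement_iff_add[of z] equal_or_complement_iff_add[of w] by simp
  then have "w \<approx> act w w"
    using equal_or_complement_perm_vec[of z "act w z" "\<pi> g"]
    by (simp add: w_def act_commute[OF wC[unfolded w_def] g])
  then show ?thesis
    unfolding w_def[symmetric] by (simp only: square_trivial_iff)
qed

lemma act_q_q: "act q q = q + all_one"
  using q_square unfolding mult_G by (metis add.commute binary_add_eq_iff)

text \<open>
  \<open>q\<close> complements itself because \<open>q\<^sup>2 = all_one\<close>, and it then complements all its translates because
  the permutations commute.
\<close>

lemma act_q_translate:
  assumes "g \<in> C" "y \<approx> act g q"
  shows "act q y = y + all_one"
proof -
  have "act q (act g q) = act g q + all_one"
    by (simp add: act_commute[OF q_in_C assms(1)] act_q_q perm_vec_add perm_vec_all_one)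
  then show ?thesis
    using assms(2)
    by (auto simp: equal_or_complement_def perm_vec_add perm_vec_all_one)
qed

text \<open>
  If \<open>q\<close> complements \<open>b\<close> and \<open>q b = q + act q b\<close> as well as itself, then it fixes \<open>q b\<close>, since the
  complements cancel in the sum.
\<close>

lemma q_not_to_both:
  assumes "g \<in> C" "h \<in> C"
  shows "\<not> (b \<approx> act g q \<and> q \<otimes>\<^bsub>G\<^esub> b \<approx> act h q)"
proof
  assume "b \<approx> act g q \<and> q \<otimes>\<^bsub>G\<^esub> b \<approx> act h q"
  then have 1: "act q b = b + all_one" and 2: "act q (q \<otimes>\<^bsub>G\<^esub> b) = q \<otimes>\<^bsub>G\<^esub> b + all_one"
    using act_q_translate assms by blast+
  have "act q (q + act q b) = q + all_one + b"
    by (simp add: 1 perm_vec_add perm_vec_all_one act_q_q add.assoc binary_add_self)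
  then have "q + all_one + b = q + (b + all_one) + all_one"
    using 2 by (simp add: mult_G 1)
  then have "q + b + all_one = q + b"
    by (simp add: ac_simps binary_add_cancel binary_add_self)
  then show False by (simp add: all_one_neq_0)
qed

text \<open>
  Up to complement, \<open>a\<close> permutes those of \<open>b\<close>, \<open>q\<close>, \<open>q b\<close> that lie in the kernel.  Without a fixed
  one there are at least two of them, hence by multiplication all three, and they form a
  cycle.  But then translates by \<open>a\<close> and \<open>a\<^sup>2\<close> carry \<open>q\<close> to both \<open>b\<close> and \<open>q b\<close>.
\<close>

lemma exists_translation_stable_involution:
  assumes "x \<in> code_kernel C" "x \<notin> {0, all_one}"
  shows "\<exists>z \<in> {b, q, q \<otimes>\<^bsub>G\<^esub> b}. z \<approx> act a z"
proof (rule ccontr)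
  let ?qb = "q \<otimes>\<^bsub>G\<^esub> b" and ?Z = "{b, q, q \<otimes>\<^bsub>G\<^esub> b}" and ?K = "code_kernel C"
  assume "\<not> (\<exists>z \<in> ?Z. z \<approx> act a z)"
  then have moves: "\<not> z \<approx> act a z" if "z \<in> ?Z" for z
    using that by blast
  have Z_nontrivial: "z \<notin> {0, all_one}" if "z \<in> ?Z" for z
    using moves[OF that] by (auto simp: perm_vec_0 perm_vec_all_one equal_or_complement_refl)
  have Z_involution: "z \<otimes>\<^bsub>G\<^esub> z \<in> {0, all_one}" if "z \<in> ?Z" for z
  proof -
    have "?qb \<otimes>\<^bsub>G\<^esub> ?qb = (q \<otimes>\<^bsub>G\<^esub> q) \<otimes>\<^bsub>G\<^esub> (b \<otimes>\<^bsub>G\<^esub> b)"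
      using q_in_C b_in_C by (simp add: mult_assoc mult_in_C mult_left_commute)
    then show ?thesis
      using that q_square b_square mult_zero[OF all_one_in_C] by auto
  qed
  have image: "\<exists>z' \<in> ?Z. z' \<in> ?K \<and> z' \<noteq> z \<and> z' \<approx> act a z" if "z \<in> ?Z" "z \<in> ?K" for z
  proof -
    have K: "act a z \<in> ?K"
      using that a_in_C by (intro kernel_act)
    have "act a z \<notin> {0, all_one}"
    proof
      assume "act a z \<in> {0, all_one}"
      then have "act (inv\<^bsub>G\<^esub> a) (act a z) \<in> {0, all_one}"
        by (auto simp: perm_vec_0 perm_vec_all_one)
      then show False using Z_nontrivial[OF that(1)] act_inv[OF a_in_C, of z] by simp
    qed
    then have "\<exists>z' \<in> ?Z. z' \<approx> act a z"
      using trivial_square_cases[of "act a z"] kernel_subset[OF K]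
        translate_of_involution[OF that(2) Z_involution[OF that(1)] a_in_C] by blast
    then show ?thesis
      using K moves[OF that(1)] kernel_equal_or_complement equal_or_complement_sym by blast
  qed
  have distinct: "\<not> q \<approx> b" "\<not> q \<approx> ?qb" "\<not> b \<approx> ?qb"
  proof -
    show "\<not> q \<approx> b" "\<not> q \<approx> ?qb"
      using pow_a_not_approx_pow_a_mult_b[of t 0] pow_a_not_approx_pow_a_mult_b[of t t]
      by (simp_all only: q_def pow_a_0 zero_mult b_in_C not_False_eq_True)
    show "\<not> b \<approx> ?qb"
    proof
      assume "b \<approx> ?qb"
      then have "b \<otimes>\<^bsub>G\<^esub> b \<approx> ?qb \<otimes>\<^bsub>G\<^esub> b"
        by (intro equal_or_complement_mult b_in_C)
      then have "0 \<approx> q"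
        using q_in_C b_in_C by (simp add: mult_assoc b_square mult_zero)
      then show False using Z_nontrivial[of q] by (simp add: equal_or_complement_0)
    qed
  qed
  have inj: "z \<approx> z'" if "y \<approx> act a z" "y \<approx> act a z'" for y z z'
  proof -
    have "act a z \<approx> act a z'"
      using that equal_or_complement_sym equal_or_complement_trans by blast
    then have "act (inv\<^bsub>G\<^esub> a) (act a z) \<approx> act (inv\<^bsub>G\<^esub> a) (act a z')"
      by (rule equal_or_complement_perm_vec)
    then show ?thesis by (simp add: act_inv[OF a_in_C])
  qed
  obtain z0 where z0: "z0 \<in> ?K" "z0 \<notin> {0, all_one}" "z0 \<otimes>\<^bsub>G\<^esub> z0 \<in> {0, all_one}"
    using nontrivial_kernel_imp_involution[OF assms] by blast
  then have "\<exists>z \<in> ?Z. z \<approx> z0"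
    using trivial_square_cases[of z0] kernel_subset by blast
  then have ex: "\<exists>z \<in> ?Z. z \<in> ?K"
    using z0(1) kernel_equal_or_complement equal_or_complement_sym by blast
  have prod_K: "?qb \<in> ?K" if "q \<in> ?K" "b \<in> ?K"
    using that by (rule kernel_mult)
  have prod_q: "q \<in> ?K" if "?qb \<in> ?K" "b \<in> ?K"
  proof -
    have "?qb \<otimes>\<^bsub>G\<^esub> b = q"
      using q_in_C b_in_C by (simp add: mult_assoc b_square mult_zero)
    then show ?thesis using kernel_mult[OF that] by simp
  qed
  have prod_b: "b \<in> ?K" if "?qb \<in> ?K" "q \<in> ?K"
  proof -
    have "q \<otimes>\<^bsub>G\<^esub> ?qb = b + all_one"
      using q_in_C b_in_C by (simp add: mult_assoc[symmetric] q_square all_one_mult)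
    then have "b + all_one \<in> ?K" using kernel_mult[OF that(2,1)] by simp
    then show ?thesis
      using kernel_add[OF _ all_one_in_kernel] binary_add_cancel by metis
  qed
  have all_K: "q \<in> ?K \<and> b \<in> ?K \<and> ?qb \<in> ?K"
  proof -
    have "\<exists>z \<in> ?Z. \<exists>z' \<in> ?Z. z \<noteq> z' \<and> z \<in> ?K \<and> z' \<in> ?K"
      using ex image by metis
    then have "q \<in> ?K \<and> b \<in> ?K \<or> ?qb \<in> ?K \<and> b \<in> ?K \<or> ?qb \<in> ?K \<and> q \<in> ?K"
      by auto
    then show ?thesis using prod_K prod_q prod_b by blast
  qed
  have image_b: "q \<approx> act a b \<or> ?qb \<approx> act a b"
    using image[of b] all_K by auto
  have image_q: "b \<approx> act a q \<or> ?qb \<approx> act a q"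
    using image[of q] all_K by auto
  have image_qb: "q \<approx> act a ?qb \<or> b \<approx> act a ?qb"
    using image[of ?qb] all_K by auto
  have two_steps: "y \<approx> act (a \<otimes>\<^bsub>G\<^esub> a) q" if "z \<approx> act a q" "y \<approx> act a z" for y z
    using that equal_or_complement_perm_vec[OF that(1), of "\<pi> a"]
    by (metis a_in_C act_act equal_or_complement_trans)
  \<comment> \<open>Injectivity of the action of \<open>a\<close> leaves two possible 3-cycles.\<close>
  from image_q show False
  proof
    assume *: "b \<approx> act a q"
    then have "q \<approx> act a ?qb"
      using image_qb inj[of b q ?qb] distinct(2) by blast
    then have "?qb \<approx> act a b"
      using image_b inj[of q b ?qb] distinct(3) by blast
    then show False
      using q_not_to_both[OF a_in_C mult_in_C[OF a_in_C a_in_C]] * two_steps by blast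
  next
    assume *: "?qb \<approx> act a q"
    then have "q \<approx> act a b"
      using image_b inj[of ?qb q b] distinct(1) by blast
    then have "b \<approx> act a ?qb"
      using image_qb inj[of q b ?qb] distinct(3) by blast
    then show False
      using q_not_to_both[OF mult_in_C[OF a_in_C a_in_C] a_in_C] * two_steps by blast
  qed
qed

section \<open>From codewords to sequences\<close>

definition coord_sign :: "'n \<Rightarrow> bit ^ 'n \<Rightarrow> int" where
  "coord_sign i x = bit_sign (x $ i)"

lemma coord_sign_cases: "coord_sign i x = 1 \<or> coord_sign i x = - 1"
  by (simp add: coord_sign_def bit_sign_cases)

lemma coord_sign_add_all_one: "coord_sign i (x + all_one) = - coord_sign i x"
  unfolding coord_sign_def by (rule bit_sign_all_one)

lemma coord_sign_mult:
  "coord_sign i (h \<otimes>\<^bsub>G\<^esub> x) = coord_sign i h * coord_sign (inv_into UNIV (\<pi> h) i) x"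
  unfolding coord_sign_def mult_G vector_add_component bit_sign_add by (simp add: perm_vec_def)

text \<open>
  The group modulo \<open>all_one\<close> acts freely on the coordinates.
\<close>

lemma same_pullback_imp_approx:
  assumes "g \<in> C" "h \<in> C" "inv_into UNIV (\<pi> g) i = inv_into UNIV (\<pi> h) i"
  shows "g \<approx> h"
proof -
  define k where "k = inv\<^bsub>G\<^esub> g \<otimes>\<^bsub>G\<^esub> h"
  have k: "k \<in> C"
    using assms(1,2) inv_closed[of g] by (simp add: k_def mult_in_C)
  have h: "h = g \<otimes>\<^bsub>G\<^esub> k"
    using assms(1,2) inv_closed[of g] by (simp add: k_def mult_assoc[symmetric] zero_mult one_G)
  define j where "j = inv_into UNIV (\<pi> g) i"
  have "\<pi> g j = i"
    using permutes_inverses(1)[OF permutes[OF assms(1)]] by (simp add: j_def)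
  moreover have "\<pi> h j = i"
    using permutes_inverses(1)[OF permutes[OF assms(2)]] by (simp add: j_def assms(3))
  ultimately have "\<pi> g (\<pi> k j) = \<pi> g j"
    using pi_mult[OF assms(1) k] by (simp add: h)
  then have "\<pi> k j = j"
    using permutes_inj[OF permutes[OF assms(1)]] by (simp add: inj_eq)
  then have "k \<in> {0, all_one}"
    by (rule fixed_point_imp_trivial[OF k])
  then show ?thesis
    using assms(1) by (auto simp: h equal_or_complement_def mult_zero mult_all_one)
qed

text \<open>
  The coordinates reached from \<open>j\<close> by the elements \<open>a\<^sup>i\<close> and \<open>a\<^sup>i b\<close> with \<open>i < 2 t\<close> are distinct, and
  there are \<open>4 t\<close> of them.  The summands are the signs of \<open>x\<close> at these coordinates, so the sum
  expresses that \<open>x\<close> is balanced.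
\<close>

lemma sum_translates_eq_0:
  assumes x: "x \<in> C" "x \<notin> {0, all_one}"
  shows "(\<Sum>i<2 * t. coord_sign j (pow_a i) * coord_sign j (pow_a i \<otimes>\<^bsub>G\<^esub> x) +
      coord_sign j (pow_a i \<otimes>\<^bsub>G\<^esub> b) * coord_sign j (pow_a i \<otimes>\<^bsub>G\<^esub> b \<otimes>\<^bsub>G\<^esub> x)) = 0"
proof -
  define p where "p h = inv_into UNIV (\<pi> h) j" for h
  let ?A = "\<lambda>i. p (pow_a i)" and ?B = "\<lambda>i. p (pow_a i \<otimes>\<^bsub>G\<^esub> b)"
  have in_C: "pow_a i \<otimes>\<^bsub>G\<^esub> b \<in> C" for i
    by (simp add: mult_in_C pow_a_in_C b_in_C)
  have eq: "i = k" if "pow_a i \<approx> pow_a k" "i < 2 * t" "k < 2 * t" for i k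
  proof -
    have "i = k" if "pow_a i \<approx> pow_a k" "i \<le> k" "k < 2 * t" for i k
    proof -
      have "2 * t dvd k - i" using that by (simp add: pow_a_approx_iff)
      moreover have "k - i < 2 * t" using that by simp
      ultimately have "k - i = 0" by (metis gr0I nat_dvd_not_less)
      then show ?thesis using that by simp
    qed
    then show ?thesis
      using that equal_or_complement_sym by (metis nat_le_linear)
  qed
  have injA: "inj_on ?A {..<2 * t}"
    using eq same_pullback_imp_approx[OF pow_a_in_C pow_a_in_C]
    by (intro inj_onI) (auto simp: p_def)
  have cancel_b: "pow_a i \<approx> pow_a k" if "pow_a i \<otimes>\<^bsub>G\<^esub> b \<approx> pow_a k \<otimes>\<^bsub>G\<^esub> b" for i k
    using equal_or_complement_mult[OF in_C b_in_C that]
    by (simp add: mult_assoc pow_a_in_C b_in_C b_square mult_zero)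
  have injB: "inj_on ?B {..<2 * t}"
    using eq cancel_b same_pullback_imp_approx[OF in_C in_C]
    by (intro inj_onI) (auto simp: p_def)
  have disj: "?A ` {..<2 * t} \<inter> ?B ` {..<2 * t} = {}"
    using same_pullback_imp_approx[OF pow_a_in_C in_C] pow_a_not_approx_pow_a_mult_b
    by (auto simp: p_def)
  have "card (?A ` {..<2 * t} \<union> ?B ` {..<2 * t}) = CARD('n)"
    using disj length by (simp add: card_Un_disjoint card_image injA injB)
  then have all: "?A ` {..<2 * t} \<union> ?B ` {..<2 * t} = UNIV"
    by (intro card_subset_eq) auto
  have "(\<Sum>i\<in>UNIV. coord_sign i x) = 0"
    unfolding coord_sign_def
    by (rule hadamard_code_balanced[OF hadamard zero_in_C x])
  then have "(\<Sum>i<2 * t. coord_sign (?A i) x) + (\<Sum>i<2 * t. coord_sign (?B i) x) = 0"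
    unfolding all[symmetric]
    by (simp add: sum.union_disjoint[OF _ _ disj] sum.reindex injA injB)
  moreover have "coord_sign j h * coord_sign j (h \<otimes>\<^bsub>G\<^esub> x) = coord_sign (p h) x" for h
    using coord_sign_cases[of j h] by (auto simp: coord_sign_mult p_def)
  ultimately show ?thesis by (simp add: sum.distrib)
qed

lemma pow_a_mult: "pow_a i \<otimes>\<^bsub>G\<^esub> pow_a k = pow_a (i + k)"
  using a_in_C by (simp add: nat_pow_mult)

lemma pow_a_b_mult: "pow_a i \<otimes>\<^bsub>G\<^esub> b \<otimes>\<^bsub>G\<^esub> pow_a k = pow_a (i + k) \<otimes>\<^bsub>G\<^esub> b"
  by (simp add: mult_assoc pow_a_in_C b_in_C b_commutes mult_in_C flip: pow_a_mult)

lemma negaperiodic_pair: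
  "negaperiodic_pair t (\<lambda>i. coord_sign j (pow_a i)) (\<lambda>i. coord_sign j (pow_a i \<otimes>\<^bsub>G\<^esub> b))"
proof
  fix i
  show "coord_sign j (pow_a i) = 1 \<or> coord_sign j (pow_a i) = - 1"
    and "coord_sign j (pow_a i \<otimes>\<^bsub>G\<^esub> b) = 1 \<or> coord_sign j (pow_a i \<otimes>\<^bsub>G\<^esub> b) = - 1"
    by (rule coord_sign_cases)+
  show "coord_sign j (pow_a (i + 2 * t)) = - coord_sign j (pow_a i)"
    by (simp only: pow_a_add_2t coord_sign_add_all_one)
  have "pow_a (i + 2 * t) \<otimes>\<^bsub>G\<^esub> b = pow_a i \<otimes>\<^bsub>G\<^esub> b + all_one"
    by (simp only: pow_a_b_mult[symmetric] a_pow_2t mult_all_one)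
  then show "coord_sign j (pow_a (i + 2 * t) \<otimes>\<^bsub>G\<^esub> b) = - coord_sign j (pow_a i \<otimes>\<^bsub>G\<^esub> b)"
    by (simp only: coord_sign_add_all_one)
next
  fix s assume s: "0 < s" "s < 2 * t"
  then have "pow_a s \<notin> {0, all_one}"
    unfolding equal_or_complement_0[symmetric] pow_a_trivial_iff by (simp add: nat_dvd_not_less)
  from sum_translates_eq_0[OF pow_a_in_C this, of j]
  show "(\<Sum>i<2 * t. coord_sign j (pow_a i) * coord_sign j (pow_a (i + s)) +
      coord_sign j (pow_a i \<otimes>\<^bsub>G\<^esub> b) * coord_sign j (pow_a (i + s) \<otimes>\<^bsub>G\<^esub> b)) = 0"
    by (simp only: pow_a_mult pow_a_b_mult)
next
  fix s
  let ?x = "pow_a s \<otimes>\<^bsub>G\<^esub> b"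
  have x: "?x \<in> C"
    by (simp add: mult_in_C pow_a_in_C b_in_C)
  have nontrivial: "?x \<notin> {0, all_one}"
    using pow_a_neq_pow_a_mult_b[of 0 s] pow_a_neq_pow_a_mult_b[of "2 * t" s]
    unfolding pow_a_0 a_pow_2t by auto
  have 1: "pow_a i \<otimes>\<^bsub>G\<^esub> ?x = pow_a (i + s) \<otimes>\<^bsub>G\<^esub> b" for i
    by (simp add: mult_assoc[symmetric] pow_a_in_C b_in_C pow_a_mult)
  have 2: "pow_a i \<otimes>\<^bsub>G\<^esub> b \<otimes>\<^bsub>G\<^esub> ?x = pow_a (i + s)" for i
    by (simp add: mult_assoc[symmetric] mult_in_C pow_a_in_C b_in_C pow_a_b_mult)
      (simp add: mult_assoc pow_a_in_C b_in_C b_square mult_zero)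
  show "(\<Sum>i<2 * t. coord_sign j (pow_a i) * coord_sign j (pow_a (i + s) \<otimes>\<^bsub>G\<^esub> b) +
      coord_sign j (pow_a i \<otimes>\<^bsub>G\<^esub> b) * coord_sign j (pow_a (i + s))) = 0"
    using sum_translates_eq_0[OF x nontrivial, of j] by (simp only: 1 2)
qed

text \<open>
  The quotient of the signs of \<open>a\<^sup>i h z\<close> and \<open>a\<^sup>i h\<close> is the sign of \<open>z\<close> at the coordinate that \<open>a\<^sup>i h\<close>
  pulls back to \<open>j\<close>.  One more factor \<open>a\<close> replaces \<open>z\<close> by \<open>act a z\<close> there, which changes the
  sign always or never.
\<close>

lemma stable_translate_modulation:
  assumes z: "z \<in> C" "z \<approx> act a z" and h: "h \<in> C"
  shows "\<exists>e. (e = 1 \<or> e = - 1) \<and>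
    (\<forall>i. coord_sign j (pow_a i \<otimes>\<^bsub>G\<^esub> h \<otimes>\<^bsub>G\<^esub> z) =
      e * (if act a z = z then 1 else - 1) ^ i * coord_sign j (pow_a i \<otimes>\<^bsub>G\<^esub> h))"
proof -
  let ?\<eta> = "if act a z = z then 1 else - 1 :: int"
  define f where "f i = coord_sign (inv_into UNIV (\<pi> (pow_a i \<otimes>\<^bsub>G\<^esub> h)) j) z" for i
  have pow_h: "pow_a i \<otimes>\<^bsub>G\<^esub> h \<in> C" for i
    by (simp add: mult_in_C pow_a_in_C h)
  have step: "f (Suc i) = ?\<eta> * f i" for i
  proof -
    let ?g = "pow_a i \<otimes>\<^bsub>G\<^esub> h"
    have "pow_a (Suc i) \<otimes>\<^bsub>G\<^esub> h = ?g \<otimes>\<^bsub>G\<^esub> a"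
      using mult_commute[OF h a_in_C] by (simp add: mult_assoc pow_a_in_C h a_in_C)
    then have "\<pi> (pow_a (Suc i) \<otimes>\<^bsub>G\<^esub> h) = \<pi> ?g \<circ> \<pi> a"
      by (simp add: pi_mult pow_h a_in_C)
    then have "inv_into UNIV (\<pi> (pow_a (Suc i) \<otimes>\<^bsub>G\<^esub> h)) j =
        inv_into UNIV (\<pi> a) (inv_into UNIV (\<pi> ?g) j)"
      by (simp only: o_inv_distrib[OF permutes_bij[OF permutes[OF pow_h]]
            permutes_bij[OF permutes[OF a_in_C]]] comp_apply)
    then have "f (Suc i) = coord_sign (inv_into UNIV (\<pi> ?g) j) (act a z)"
      by (simp add: f_def coord_sign_def perm_vec_def)
    then show ?thesis
      using z(2) by (auto simp: equal_or_complement_def f_def coord_sign_add_all_one)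
  qed
  have f: "f i = f 0 * ?\<eta> ^ i" for i
    by (induction i) (simp_all add: step)
  have "coord_sign j (pow_a i \<otimes>\<^bsub>G\<^esub> h \<otimes>\<^bsub>G\<^esub> z) =
      f 0 * ?\<eta> ^ i * coord_sign j (pow_a i \<otimes>\<^bsub>G\<^esub> h)" for i
    unfolding coord_sign_mult[of j "pow_a i \<otimes>\<^bsub>G\<^esub> h"] f_def[symmetric] f[of i] by simp
  moreover have "f 0 = 1 \<or> f 0 = - 1"
    unfolding f_def by (rule coord_sign_cases)
  ultimately show ?thesis by blast
qed

text \<open>
  Each of the three candidates for a stable kernel element makes the pair of sequences degenerate in
  one of the ways excluded above.
\<close>

lemma kernel_trivial:
  assumes "t \<ge> 3"
  shows "code_kernel C = {0, all_one}"
proof (rule ccontr)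
  assume "code_kernel C \<noteq> {0, all_one}"
  then obtain x where "x \<in> code_kernel C" "x \<notin> {0, all_one}"
    using zero_in_kernel all_one_in_kernel by blast
  then obtain z where z: "z \<in> {b, q, q \<otimes>\<^bsub>G\<^esub> b}" "z \<approx> act a z"
    using exists_translation_stable_involution by blast
  then have zC: "z \<in> C"
    using b_in_C q_in_C mult_in_C by auto
  \<comment> \<open>Any coordinate will do.\<close>
  define j where "j = (undefined :: 'n)"
  interpret negaperiodic_pair t "\<lambda>i. coord_sign j (pow_a i)" "\<lambda>i. coord_sign j (pow_a i \<otimes>\<^bsub>G\<^esub> b)"
    by (rule negaperiodic_pair)
  define \<eta> where "\<eta> = (if act a z = z then 1 else - 1 :: int)"
  have \<eta>: "\<eta> = 1 \<or> \<eta> = - 1"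
    by (simp add: \<eta>_def)
  obtain e where e: "e = 1 \<or> e = - 1"
    "\<And>i. coord_sign j (pow_a i \<otimes>\<^bsub>G\<^esub> z) = e * \<eta> ^ i * coord_sign j (pow_a i)"
    using stable_translate_modulation[OF zC z(2) zero_in_C, of j]
    by (auto simp: mult_zero pow_a_in_C \<eta>_def)
  obtain e' where e': "e' = 1 \<or> e' = - 1"
    "\<And>i. coord_sign j (pow_a i \<otimes>\<^bsub>G\<^esub> b \<otimes>\<^bsub>G\<^esub> z) = e' * \<eta> ^ i * coord_sign j (pow_a i \<otimes>\<^bsub>G\<^esub> b)"
    using stable_translate_modulation[OF zC z(2) b_in_C, of j] unfolding \<eta>_def by blast
  from z(1) consider "z = b" | "z = q" | "z = q \<otimes>\<^bsub>G\<^esub> b"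
    by blast
  then show False
  proof cases
    case 1
    then show ?thesis
      using no_modulated_copy[OF assms \<eta> e(1)] e(2) by simp
  next
    case 2
    have "coord_sign j (pow_a (i + t)) = e * \<eta> ^ i * coord_sign j (pow_a i)" for i
      using e(2)[of i] by (simp add: 2 q_def pow_a_mult)
    moreover have "coord_sign j (pow_a (i + t) \<otimes>\<^bsub>G\<^esub> b) =
        e' * \<eta> ^ i * coord_sign j (pow_a i \<otimes>\<^bsub>G\<^esub> b)" for i
      using e'(2)[of i] by (simp add: 2 q_def pow_a_b_mult)
    ultimately show ?thesis
      using no_half_period_modulation[OF _ \<eta> e(1) e'(1)] assms by simp
  next
    case 3
    have "coord_sign j (pow_a (i + t) \<otimes>\<^bsub>G\<^esub> b) = e * \<eta> ^ i * coord_sign j (pow_a i)" for i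
      using e(2)[of i]
      by (simp add: 3 q_def mult_assoc[symmetric] pow_a_in_C b_in_C pow_a_mult)
    then show ?thesis
      using no_half_period_exchange[OF _ \<eta> e(1)] assms by simp
  qed
qed

end

lemma dim_zero_all_one: "vec.dim {0, all_one :: bit ^ 'n} = 1"
proof -
  have bit: "c = 0 \<or> c = 1" for c :: bit
    by (cases c) simp_all
  have "vec.span {all_one :: bit ^ 'n} = {0, all_one}"
  proof (intro equalityI subsetI)
    fix x :: "bit ^ 'n" assume "x \<in> vec.span {all_one}"
    then obtain c where "x = c *s all_one"
      by (auto simp: vec.span_singleton)
    then show "x \<in> {0, all_one}"
      using bit[of c] by auto
  next
    fix x :: "bit ^ 'n" assume "x \<in> {0, all_one}"
    then show "x \<in> vec.span {all_one}"
      by (auto intro: vec.span_zero vec.span_base)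
  qed
  then have "vec.dim {0, all_one :: bit ^ 'n} = vec.dim {all_one :: bit ^ 'n}"
    using vec.dim_span[of "{all_one :: bit ^ 'n}"] by simp
  also have "\<dots> = 1"
    by (subst vec.dim_eq_card_independent) (simp_all add: vec.dependent_single all_one_neq_0)
  finally show ?thesis .
qed

theorem theorem3p14:
  fixes C :: "(bit ^ 'n) set" and \<pi> :: "bit ^ 'n \<Rightarrow> 'n \<Rightarrow> 'n" and t :: nat
  assumes "hfp_4tu_2_code t C \<pi>" and "t \<ge> 4"
  shows "vec.dim (code_kernel C) = 1"
proof -
  obtain a b where "hfp_4tu_2 C \<pi> t a b"
    using assms(1)
    by (auto simp: hfp_4tu_2_code_def Let_def hfp_4tu_2_def hfp_4tu_2_axioms_def hfp_def)
  then have "code_kernel C = {0, all_one}"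
    using assms(2) by (intro hfp_4tu_2.kernel_trivial) auto
  then show ?thesis
    by (simp only: dim_zero_all_one)
qed

end
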